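(* Let $G$ be a unicyclic graph and let $Q$ be the unique cycle of $G$. Then $G$ is sign-invertible if and only if $G$ is $K_2$-reducible, the number of pegs of $Q$ is at least two, and equality holds (that is, $Q$ has exactly two pegs) only if the attachments $v_1,v_2$ of the two pegs separate $Q$ into two $(v_1,v_2)$-paths of even lengths not congruent modulo $4$, where the length of such a path is its number of vertices.
   Context: Graphs have no multi-edges but may have loops. A unicyclic graph is a connected graph with cycle rank one, where the cycle rank is the smallest number of edges whose removal results in a subgraph without cycles. A graph with adjacency matrix $A$ is sign-invertible if $A$ is invertible and every entry of $A^{-1}$ lies in $\{-1,0,1\}$. If $v$ is a vertex of degree one in a graph with unique neighbor $u$, a $K_2$-reduction deletes both $u$ and $v$. A graph is $K_2$-reducible if it can be reduced to the empty graph by a series of $K_2$-reductions; it then has a unique perfect matching $M$. For a cycle $C$ of a $K_2$-reducible graph, a peg of $C$ is an edge of $M$ with exactly one end-vertex on $C$; the attachment of the peg is meant here as that end-vertex on $C$.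
   Formalization: A loop is taken to contribute 2 to the diagonal of the adjacency matrix; with entry 1 the claim fails when the cycle is a loop (a single looped vertex has A=[1], sign-invertible, but is not K_2-reducible). For cycles of length at least three nothing changes. *)

theory Defs
  imports "HOL-Analysis.Analysis"
begin

text \<open>
  Undirected graphs without multi-edges, loops permitted. An edge is the set of its ends, so that a
  loop at \<open>v\<close> is the singleton \<open>{v}\<close>.
\<close>

record 'v ugraph =
  verts :: "'v set"
  edges :: "'v set set"

definition is_graph :: "'v ugraph \<Rightarrow> bool" where
  "is_graph G \<longleftrightarrow>
     finite (verts G) \<and> (\<forall>e\<in>edges G. e \<subseteq> verts G \<and> (card e = 1 \<or> card e = 2))"

definition empty_graph :: "'v ugraph" where
  "empty_graph = \<lparr>verts = {}, edges = {}\<rparr>"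

definition subgraph_of :: "'v ugraph \<Rightarrow> 'v ugraph \<Rightarrow> bool" where
  "subgraph_of H G \<longleftrightarrow> verts H \<subseteq> verts G \<and> edges H \<subseteq> edges G"

definition delete_verts :: "'v ugraph \<Rightarrow> 'v set \<Rightarrow> 'v ugraph" where
  "delete_verts G S = \<lparr>verts = verts G - S, edges = {e \<in> edges G. e \<inter> S = {}}\<rparr>"

definition delete_edges :: "'v ugraph \<Rightarrow> 'v set set \<Rightarrow> 'v ugraph" where
  "delete_edges G F = \<lparr>verts = verts G, edges = edges G - F\<rparr>"

definition graph_connected :: "'v ugraph \<Rightarrow> bool" where
  "graph_connected G \<longleftrightarrow>
     verts G \<noteq> {} \<and> (\<forall>u\<in>verts G. \<forall>v\<in>verts G. (u, v) \<in> {(x, y). {x, y} \<in> edges G}\<^sup>*)"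

text \<open>A loop counts twice, because it is counted by both summands.\<close>

definition vertex_degree :: "'v ugraph \<Rightarrow> 'v \<Rightarrow> nat" where
  "vertex_degree G v = card {e \<in> edges G. v \<in> e} + card {e \<in> edges G. e = {v}}"

text \<open>
  Length 1 gives a vertex with a loop. Length 2 is excluded: it would traverse a single edge twice,
  which is a cycle only in the presence of multi-edges.
\<close>

definition is_cycle :: "'v ugraph \<Rightarrow> bool" where
  "is_cycle C \<longleftrightarrow>
     (\<exists>xs. distinct xs \<and> xs \<noteq> [] \<and> length xs \<noteq> 2 \<and> verts C = set xs \<and>
           edges C = {{xs ! i, xs ! (Suc i mod length xs)} | i. i < length xs})"

definition has_cycle :: "'v ugraph \<Rightarrow> bool" where
  "has_cycle G \<longleftrightarrow> (\<exists>C. is_cycle C \<and> subgraph_of C G)"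

definition cycle_rank :: "'v ugraph \<Rightarrow> nat" where
  "cycle_rank G =
     (LEAST k. \<exists>F. F \<subseteq> edges G \<and> card F = k \<and> \<not> has_cycle (delete_edges G F))"

definition unicyclic :: "'v ugraph \<Rightarrow> bool" where
  "unicyclic G \<longleftrightarrow> graph_connected G \<and> cycle_rank G = 1"

text \<open>
  The entry at \<open>(u, v)\<close> is the number of edges joining \<open>u\<close> and \<open>v\<close>, a loop being counted as two
  edges (the convention of Bondy and Murty). Row sums are then the vertex degrees. The matrix is
  indexed by the whole vertex type, hence is the adjacency matrix of \<open>G\<close> for \<open>verts G = UNIV\<close>.
\<close>

definition adjacency_matrix :: "('v::finite) ugraph \<Rightarrow> real ^ 'v ^ 'v" where
  "adjacency_matrix G =
     (\<chi> u v. if {u, v} \<in> edges G then (if u = v then 2 else 1) else 0)"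

definition sign_invertible :: "('v::finite) ugraph \<Rightarrow> bool" where
  "sign_invertible G \<longleftrightarrow>
     invertible (adjacency_matrix G) \<and>
     (\<forall>u v. matrix_inv (adjacency_matrix G) $ u $ v \<in> {-1, 0, 1})"

definition K2_reduction :: "'v ugraph \<Rightarrow> 'v ugraph \<Rightarrow> bool" where
  "K2_reduction G H \<longleftrightarrow>
     (\<exists>v\<in>verts G. \<exists>u. vertex_degree G v = 1 \<and> {v, u} \<in> edges G \<and> H = delete_verts G {u, v})"

definition K2_reducible :: "'v ugraph \<Rightarrow> bool" where
  "K2_reducible G \<longleftrightarrow> K2_reduction\<^sup>*\<^sup>* G empty_graph"

definition perfect_matching :: "'v ugraph \<Rightarrow> 'v set set \<Rightarrow> bool" where
  "perfect_matching G M \<longleftrightarrow>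
     M \<subseteq> edges G \<and> (\<forall>e\<in>M. card e = 2) \<and> (\<forall>v\<in>verts G. \<exists>!e. e \<in> M \<and> v \<in> e)"

text \<open>Meaningful for graphs with a unique perfect matching, such as \<open>K\<^sub>2\<close>-reducible graphs.\<close>

definition the_perfect_matching :: "'v ugraph \<Rightarrow> 'v set set" where
  "the_perfect_matching G = (THE M. perfect_matching G M)"

definition pegs :: "'v ugraph \<Rightarrow> 'v ugraph \<Rightarrow> 'v set set" where
  "pegs G C = {e \<in> the_perfect_matching G. card (e \<inter> verts C) = 1}"

definition peg_attachments :: "'v ugraph \<Rightarrow> 'v ugraph \<Rightarrow> 'v set" where
  "peg_attachments G C = (\<Union>e\<in>pegs G C. e \<inter> verts C)"

text \<open>Paths are given by their lists of vertices, so the length of a path is its list length.\<close>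

definition path_edges :: "'v list \<Rightarrow> 'v set set" where
  "path_edges p = {{p ! i, p ! Suc i} | i. Suc i < length p}"

definition path_between :: "'v ugraph \<Rightarrow> 'v \<Rightarrow> 'v list \<Rightarrow> 'v \<Rightarrow> bool" where
  "path_between G u p v \<longleftrightarrow>
     p \<noteq> [] \<and> distinct p \<and> hd p = u \<and> last p = v \<and>
     set p \<subseteq> verts G \<and> path_edges p \<subseteq> edges G"

definition separates_into ::
    "'v ugraph \<Rightarrow> 'v \<Rightarrow> 'v \<Rightarrow> 'v list \<Rightarrow> 'v list \<Rightarrow> bool" where
  "separates_into C u v p q \<longleftrightarrow>
     path_between C u p v \<and> path_between C u q v \<and>
     set p \<inter> set q = {u, v} \<and> set p \<union> set q = verts C \<and>
     path_edges p \<inter> path_edges q = {} \<and> path_edges p \<union> path_edges q = edges C"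

end

theory Submission
  imports Defs
begin

text \<open>
  A \<open>K\<^sub>2\<close>-reduction that deletes a leaf \<open>v\<close> and its neighbour \<open>u\<close> turns the inverse of the smaller
  adjacency matrix into a principal submatrix of the inverse of the larger one; the only new entries
  that are not 0 or 1 lie in row and column \<open>v\<close> and are signed sums of old entries over the
  neighbours of \<open>u\<close>. In a forest those neighbours lie in different components, so by induction the
  \<open>(x, y)\<close> entry is \<open>\<plusminus>1\<close> when \<open>x\<close> and \<open>y\<close> are joined by a path alternating with the perfect
  matching, and 0 otherwise. In a unicyclic graph this only changes at the step where \<open>u\<close> lies on the
  cycle: there \<open>u\<close> has two neighbours \<open>a\<close>, \<open>b\<close> that stay connected, so the new entries are
  \<open>2 B(a, b)\<close> and \<open>-(B(a, x) + B(b, x))\<close>. The first vanishes unless \<open>u\<close> is the only attachment. Both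
  terms of the second are nonzero only if there is exactly one further attachment, and then their
  signs agree iff 4 does not divide the length of the cycle.

  If \<open>G\<close> is not \<open>K\<^sub>2\<close>-reducible, then reducing it as far as possible leaves a nonempty graph with at
  most as many edges as vertices and no vertex of degree 1, hence with an isolated vertex or with all
  degrees 2. Either way the adjacency matrix is singular modulo 2, a property that lifts back along
  reductions and contradicts an integral inverse.
\<close>

section \<open>Paths and cycles\<close>

text \<open>Once the cycle is present, the entries of the inverse are no longer described by
  alternating paths. Building the graph up from the empty one, the induction therefore changes its
  invariant at the step that completes \<open>Q\<close>. Up to there the graph is a forest and all
  entries are known exactly; afterwards, in the good case, it is enough that entries lie in {-1, 0,
  1}, that the diagonal vanishes and that nonzero entries stay within components. An inadmissible
  entry survives all later steps, because old entries are kept.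

  A leaf never lies on a cycle, so the hub of the critical step is itself an attachment, and the
  question becomes which other cycle vertices have their mates off the cycle.

  Modulo 2 the all-ones vector lies in the kernel as soon as all degrees are even. Loops fit in
  because their weight 2 makes row sums equal to degrees.\<close>

lemma path_edges_simps [simp]:
  "path_edges [] = {}" "path_edges [x] = {}"
  "path_edges (x # y # p) = insert {x, y} (path_edges (y # p))"
proof -
  show "path_edges [] = {}" "path_edges [x] = {}" by (auto simp: path_edges_def)
  have "e \<in> path_edges (x # y # p) \<longleftrightarrow> e \<in> insert {x, y} (path_edges (y # p))" for e
  proof
    assume "e \<in> path_edges (x # y # p)"
    then obtain i where i: "e = {(x # y # p) ! i, (x # y # p) ! Suc i}" "Suc i < length (x # y # p)"
      unfolding path_edges_def by blast
    show "e \<in> insert {x, y} (path_edges (y # p))"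
    proof (cases i)
      case 0
      then show ?thesis using i by simp
    next
      case (Suc j)
      then have "e = {(y # p) ! j, (y # p) ! Suc j}" "Suc j < length (y # p)" using i by auto
      then show ?thesis unfolding path_edges_def by blast
    qed
  next
    assume "e \<in> insert {x, y} (path_edges (y # p))"
    then consider "e = {x, y}" | i where "e = {(y # p) ! i, (y # p) ! Suc i}" "Suc i < length (y # p)"
      unfolding path_edges_def by blast
    then show "e \<in> path_edges (x # y # p)"
    proof cases
      case 1
      then have "e = {(x # y # p) ! 0, (x # y # p) ! Suc 0}" "Suc 0 < length (x # y # p)" by auto
      then show ?thesis unfolding path_edges_def by blast
    next
      case (2 i)
      then have "e = {(x # y # p) ! Suc i, (x # y # p) ! Suc (Suc i)}"
        "Suc (Suc i) < length (x # y # p)" by auto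
      then show ?thesis unfolding path_edges_def by blast
    qed
  qed
  then show "path_edges (x # y # p) = insert {x, y} (path_edges (y # p))" by blast
qed

lemma path_edges_Cons:
  "p \<noteq> [] \<Longrightarrow> path_edges (x # p) = insert {x, hd p} (path_edges p)"
  by (cases p) auto

lemma path_edges_append:
  "p \<noteq> [] \<Longrightarrow> q \<noteq> [] \<Longrightarrow>
    path_edges (p @ q) = insert {last p, hd q} (path_edges p \<union> path_edges q)"
proof (induction p)
  case (Cons a p)
  then show ?case by (cases "p = []") (auto simp: path_edges_Cons)
qed simp

lemma path_edges_rev [simp]: "path_edges (rev p) = path_edges p"
proof (induction p)
  case (Cons a p)
  then show ?case
    by (cases "p = []") (auto simp: path_edges_Cons path_edges_append last_rev insert_commute)
qed simp

lemma path_edges_subset_set: "e \<in> path_edges p \<Longrightarrow> e \<subseteq> set p"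
  unfolding path_edges_def using Suc_lessD nth_mem by fastforce

lemma path_between_rev: "path_between G x p y \<Longrightarrow> path_between G y (rev p) x"
  by (auto simp: path_between_def hd_rev last_rev)

lemma path_between_suffix:
  assumes "path_between G x (p @ q) y" "q \<noteq> []"
  shows "path_between G (hd q) q y"
  using assms by (cases "p = []") (auto simp: path_between_def path_edges_append)

lemma path_between_prefix:
  assumes "path_between G x (p @ q) y" "p \<noteq> []"
  shows "path_between G x p (last p)"
  using assms by (cases "q = []") (auto simp: path_between_def path_edges_append)

lemma path_between_Cons:
  assumes "path_between G x p y" "a \<in> verts G" "{a, x} \<in> edges G" "a \<notin> set p"
  shows "path_between G a (a # p) y"
  using assms by (auto simp: path_between_def path_edges_Cons)

lemma path_between_verts: "path_between G x p y \<Longrightarrow> x \<in> verts G \<and> y \<in> verts G"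
  by (auto simp: path_between_def)

text \<open>Simple paths are required, since only these close up to cycles; the price is that
  transitivity has to cut out repeated vertices.\<close>

definition linked :: "'v ugraph \<Rightarrow> 'v \<Rightarrow> 'v \<Rightarrow> bool" where
  "linked G x y \<longleftrightarrow> (\<exists>p. path_between G x p y)"

lemma linked_refl: "x \<in> verts G \<Longrightarrow> linked G x x"
  unfolding linked_def by (intro exI[of _ "[x]"]) (simp add: path_between_def)

lemma linked_sym: "linked G x y \<Longrightarrow> linked G y x"
  unfolding linked_def by (metis path_between_rev)

lemma linked_edge_trans:
  assumes "linked G y z" "x \<in> verts G" "{x, y} \<in> edges G"
  shows "linked G x z"
proof -
  obtain q where q: "path_between G y q z" using assms unfolding linked_def by blast
  show ?thesis
  proof (cases "x \<in> set q")
    case True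
    then obtain as bs where "q = as @ x # bs" by (meson split_list)
    then have "path_between G x (x # bs) z" using path_between_suffix[of G y as "x # bs" z] q by auto
    then show ?thesis unfolding linked_def by blast
  next
    case False
    then show ?thesis using path_between_Cons[OF q assms(2,3)] unfolding linked_def by blast
  qed
qed

lemma linked_trans:
  assumes "linked G x y" "linked G y z"
  shows "linked G x z"
proof -
  obtain p where "path_between G x p y" using assms unfolding linked_def by blast
  then show ?thesis
  proof (induction p arbitrary: x)
    case Nil
    then show ?case by (simp add: path_between_def)
  next
    case (Cons a p)
    show ?case
    proof (cases "p = []")
      case True
      then show ?thesis using Cons.prems assms by (auto simp: path_between_def)
    next
      case False
      then have "linked G (hd p) z"
        using Cons path_between_suffix[of G x "[a]" p y] by auto
      then show ?thesis using Cons.prems False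
        by (intro linked_edge_trans[of G "hd p" z x]) (auto simp: path_between_def path_edges_Cons)
    qed
  qed
qed

section \<open>Subgraphs and deletion of vertices\<close>

lemma path_between_mono:
  "path_between H x p y \<Longrightarrow> subgraph_of H G \<Longrightarrow> path_between G x p y"
  by (auto simp: path_between_def subgraph_of_def)

lemma linked_mono: "linked H x y \<Longrightarrow> subgraph_of H G \<Longrightarrow> linked G x y"
  unfolding linked_def by (metis path_between_mono)

lemma subgraph_trans: "subgraph_of F H \<Longrightarrow> subgraph_of H G \<Longrightarrow> subgraph_of F G"
  by (auto simp: subgraph_of_def)

lemma subgraph_delete_verts: "subgraph_of (delete_verts G S) G"
  by (auto simp: subgraph_of_def delete_verts_def)

lemma linked_delete_verts: "linked (delete_verts G S) x y \<Longrightarrow> linked G x y"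
  using linked_mono[OF _ subgraph_delete_verts] .

text \<open>A list form of cycles that suits rotation, reversal and splitting. A one-element list
  gives a loop, because \<open>{last xs, hd xs}\<close> is then a singleton.\<close>

definition cycle_of :: "'v list \<Rightarrow> 'v ugraph" where
  "cycle_of xs = \<lparr>verts = set xs, edges = insert {last xs, hd xs} (path_edges xs)\<rparr>"

lemma cycle_of_sel [simp]:
  "verts (cycle_of xs) = set xs"
  "edges (cycle_of xs) = insert {last xs, hd xs} (path_edges xs)"
  by (simp_all add: cycle_of_def)

lemma cyclic_edges:
  assumes "xs \<noteq> []"
  shows "{{xs ! i, xs ! (Suc i mod length xs)} | i. i < length xs}
    = insert {last xs, hd xs} (path_edges xs)" (is "?L = ?R")
proof (intro equalityI subsetI)
  fix e assume "e \<in> ?L"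
  then obtain i where i: "e = {xs ! i, xs ! (Suc i mod length xs)}" "i < length xs" by blast
  show "e \<in> ?R"
  proof (cases "Suc i < length xs")
    case True
    then show ?thesis using i unfolding path_edges_def by auto
  next
    case False
    then have "Suc i = length xs" using i by simp
    moreover from this have "i = length xs - 1" by simp
    ultimately show ?thesis using i assms by (simp add: last_conv_nth hd_conv_nth)
  qed
next
  fix e assume "e \<in> ?R"
  then consider "e = {last xs, hd xs}" | i where "e = {xs ! i, xs ! Suc i}" "Suc i < length xs"
    unfolding path_edges_def by blast
  then show "e \<in> ?L"
  proof cases
    case 1
    have "Suc (length xs - 1) = length xs" using assms by simp
    then have "e = {xs ! (length xs - 1), xs ! (Suc (length xs - 1) mod length xs)}"
      using 1 assms by (simp add: last_conv_nth hd_conv_nth)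
    moreover have "length xs - 1 < length xs" using assms by simp
    ultimately show ?thesis unfolding mem_Collect_eq by (intro exI conjI)
  next
    case (2 i)
    then have "e = {xs ! i, xs ! (Suc i mod length xs)}" "i < length xs" by auto
    then show ?thesis unfolding mem_Collect_eq by (intro exI conjI)
  qed
qed

lemma is_cycle_iff:
  "is_cycle C \<longleftrightarrow> (\<exists>xs. distinct xs \<and> xs \<noteq> [] \<and> length xs \<noteq> 2 \<and> C = cycle_of xs)"
proof -
  have "C = cycle_of xs \<longleftrightarrow> verts C = set xs \<and>
           edges C = insert {last xs, hd xs} (path_edges xs)" for xs
    by (cases C) (simp add: cycle_of_def)
  then have "C = cycle_of xs \<longleftrightarrow> verts C = set xs \<and>
           edges C = {{xs ! i, xs ! (Suc i mod length xs)} | i. i < length xs}" if "xs \<noteq> []" for xs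
    by (simp only: cyclic_edges[OF that])
  then show ?thesis unfolding is_cycle_def by (intro arg_cong[where f = Ex] ext) (simp cong: conj_cong)
qed

lemma cycle_of_rotate: "cycle_of (p @ q) = cycle_of (q @ p)"
  by (cases "p = [] \<or> q = []") (auto simp: cycle_of_def path_edges_append)

lemma cycle_of_rev: "cycle_of (rev p) = cycle_of p"
  by (cases "p = []") (auto simp: cycle_of_def hd_rev last_rev insert_commute)

lemma cycle_through_vertex:
  assumes "is_cycle C" "u \<in> verts C"
  obtains ys where "distinct (u # ys)" "length (u # ys) \<noteq> 2" "C = cycle_of (u # ys)"
proof -
  obtain xs where xs: "distinct xs" "xs \<noteq> []" "length xs \<noteq> 2" "C = cycle_of xs"
    using assms(1) is_cycle_iff by blast
  then obtain as bs where "xs = as @ u # bs" using assms(2) by (metis cycle_of_sel(1) split_list)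
  then show ?thesis using xs that[of "bs @ as"] cycle_of_rotate[of as "u # bs"] by auto
qed

text \<open>Rotation brings \<open>f\<close> into the closing position. That \<open>f\<close> is not
  also a path edge is where length 2 has to be excluded: there the closing edge is the only path
  edge.\<close>

lemma cycle_through_edge:
  assumes "is_cycle C" "f \<in> edges C"
  obtains xs where "distinct xs" "xs \<noteq> []" "length xs \<noteq> 2" "C = cycle_of xs"
    "f = {last xs, hd xs}" "f \<notin> path_edges xs"
proof -
  obtain xs where xs: "distinct xs" "xs \<noteq> []" "length xs \<noteq> 2" "C = cycle_of xs"
    using assms(1) is_cycle_iff by blast
  have "\<exists>xs. distinct xs \<and> xs \<noteq> [] \<and> length xs \<noteq> 2 \<and> C = cycle_of xs \<and> f = {last xs, hd xs}"
  proof (cases "f = {last xs, hd xs}")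
    case True
    then show ?thesis using xs by blast
  next
    case False
    then have "f \<in> path_edges xs" using xs assms by auto
    then obtain i where i: "f = {xs ! i, xs ! Suc i}" "Suc i < length xs"
      unfolding path_edges_def by blast
    let ?p = "take (Suc i) xs" and ?q = "drop (Suc i) xs"
    have "f = {last (?q @ ?p), hd (?q @ ?p)}"
      using i by (simp add: last_append take_Suc_conv_app_nth hd_drop_conv_nth)
    moreover have "distinct (?q @ ?p)"
      using xs(1) by (metis append_take_drop_id distinct_append inf_commute)
    moreover have "?q @ ?p \<noteq> []" using i by auto
    moreover have "length (?q @ ?p) \<noteq> 2" using xs i by auto
    moreover have "C = cycle_of (?q @ ?p)"
      using xs cycle_of_rotate[of ?p ?q] by simp
    ultimately show ?thesis by blast
  qed
  then obtain zs where zs: "distinct zs" "zs \<noteq> []" "length zs \<noteq> 2" "C = cycle_of zs"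
    "f = {last zs, hd zs}" by blast
  have "f \<notin> path_edges zs"
  proof
    assume f: "f \<in> path_edges zs"
    then obtain a b p where z: "zs = a # b # p" using zs by (cases zs; cases "tl zs") auto
    then have "p \<noteq> []" using zs by auto
    then have "last zs \<in> set p" using z by auto
    then show False using f zs z path_edges_subset_set[of f "b # p"]
      by (auto simp: doubleton_eq_iff)
  qed
  then show ?thesis using zs that by blast
qed

text \<open>Distinct ends force at least two vertices on \<open>p\<close>, so \<open>a # p\<close>
  does not have the forbidden length 2.\<close>

lemma path_closes_to_cycle:
  assumes "path_between G x p y" "{a, x} \<in> edges G" "{a, y} \<in> edges G" "a \<in> verts G"
    "a \<notin> set p" "x \<noteq> y"
  shows "is_cycle (cycle_of (a # p))" "subgraph_of (cycle_of (a # p)) G"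
proof -
  have "length p \<noteq> 1" using assms(1,6) unfolding path_between_def by (cases p) auto
  then show "is_cycle (cycle_of (a # p))"
    unfolding is_cycle_iff using assms by (intro exI[of _ "a # p"]) (auto simp: path_between_def)
  show "subgraph_of (cycle_of (a # p)) G" using assms
    by (auto simp: path_between_def subgraph_of_def path_edges_Cons insert_commute)
qed

lemma loop_is_cycle:
  assumes "{a} \<in> edges G" "a \<in> verts G"
  shows "is_cycle (cycle_of [a])" "subgraph_of (cycle_of [a]) G"
  using assms by (auto simp: is_cycle_iff subgraph_of_def intro!: exI[of _ "[a]"])

section \<open>Acyclic graphs\<close>

lemma has_cycle_mono: "has_cycle H \<Longrightarrow> subgraph_of H G \<Longrightarrow> has_cycle G"
  unfolding has_cycle_def using subgraph_trans by blast

text \<open>A path that joins two distinct neighbours of \<open>a\<close> and avoids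
  \<open>a\<close> closes up to a cycle. With \<open>S\<close> the pair removed by a reduction, this
  puts the neighbours of the hub into different components.\<close>

lemma acyclic_linked_neighbours:
  assumes "\<not> has_cycle G" "linked (delete_verts G S) x y" "a \<in> S" "a \<in> verts G"
    "{a, x} \<in> edges G" "{a, y} \<in> edges G"
  shows "x = y"
proof (rule ccontr)
  assume "x \<noteq> y"
  obtain p where p: "path_between (delete_verts G S) x p y" using assms unfolding linked_def by blast
  then have "path_between G x p y" using path_between_mono subgraph_delete_verts by metis
  moreover have "a \<notin> set p" using p assms by (auto simp: path_between_def delete_verts_def)
  ultimately show False using path_closes_to_cycle[of G x p y a] assms \<open>x \<noteq> y\<close>
    unfolding has_cycle_def by blast
qed

lemma path_between_delete:
  assumes "path_between G x p y" "set p \<inter> S = {}"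
  shows "path_between (delete_verts G S) x p y"
proof -
  have "e \<inter> S = {}" if "e \<in> path_edges p" for e
    using path_edges_subset_set[OF that] assms(2) by blast
  then show ?thesis using assms by (auto simp: path_between_def delete_verts_def)
qed

text \<open>After the common first vertex \<open>x\<close> both paths continue to \<open>y\<close>
  without meeting \<open>x\<close> again. Their second vertices are thus neighbours of
  \<open>x\<close> that are linked off \<open>x\<close>, hence equal.\<close>

lemma acyclic_path_unique:
  assumes "\<not> has_cycle G" "path_between G x p y" "path_between G x q y"
  shows "p = q"
  using assms(2,3)
proof (induction p arbitrary: x q)
  case Nil
  then show ?case by (simp add: path_between_def)
next
  case (Cons a p)
  then have ax: "a = x" and xv: "x \<in> verts G" by (auto simp: path_between_def)
  from Cons.prems(2) obtain r where q: "q = x # r" by (cases q) (auto simp: path_between_def)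
  show ?case
  proof (cases "p = [] \<or> r = []")
    case True
    then have "y = x" using Cons.prems q ax by (auto simp: path_between_def)
    then have "p = []" "r = []" using Cons.prems q ax by (auto simp: path_between_def split: if_splits)
    then show ?thesis using q ax by simp
  next
    case False
    then have p': "path_between G (hd p) p y" and r': "path_between G (hd r) r y"
      using Cons.prems q path_between_suffix[of G x "[a]" p y] path_between_suffix[of G x "[x]" r y]
      by auto
    have nx: "x \<notin> set p" "x \<notin> set r" using Cons.prems q ax by (auto simp: path_between_def)
    then have "linked (delete_verts G {x}) (hd p) y" "linked (delete_verts G {x}) (hd r) y"
      using path_between_delete[OF p', of "{x}"] path_between_delete[OF r', of "{x}"]
      unfolding linked_def by auto
    then have "linked (delete_verts G {x}) (hd p) (hd r)" using linked_trans linked_sym by metis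
    moreover have "{x, hd p} \<in> edges G" "{x, hd r} \<in> edges G"
      using Cons.prems q ax False by (auto simp: path_between_def path_edges_Cons)
    ultimately have "hd p = hd r" using acyclic_linked_neighbours assms(1) xv by fastforce
    then show ?thesis using Cons.IH[OF p'] r' q ax by auto
  qed
qed

section \<open>Inverses along \<open>K\<^sub>2\<close>-reductions\<close>

definition adj :: "'v ugraph \<Rightarrow> 'v \<Rightarrow> 'v \<Rightarrow> nat" where
  "adj G x y = (if {x, y} \<in> edges G then (if x = y then 2 else 1) else 0)"

lemma adj_commute: "adj G x y = adj G y x"
  by (simp add: adj_def insert_commute)

lemma adj_delete_verts: "x \<notin> S \<Longrightarrow> y \<notin> S \<Longrightarrow> adj (delete_verts G S) x y = adj G x y"
  by (simp add: adj_def delete_verts_def)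

lemma is_graph_delete_verts: "is_graph G \<Longrightarrow> is_graph (delete_verts G S)"
  by (auto simp: is_graph_def delete_verts_def)

lemma finite_edges: "is_graph G \<Longrightarrow> finite (edges G)"
  by (rule finite_subset[of _ "Pow (verts G)"]) (auto simp: is_graph_def)

lemma edge_verts: "is_graph G \<Longrightarrow> {x, y} \<in> edges G \<Longrightarrow> x \<in> verts G \<and> y \<in> verts G"
  by (auto simp: is_graph_def)

text \<open>Here \<open>v\<close> is the leaf and \<open>u\<close> its hub. A loop at
  \<open>v\<close> is excluded by the last clause, a loop at \<open>u\<close> is not.\<close>

definition leaf_pair :: "'v ugraph \<Rightarrow> 'v \<Rightarrow> 'v \<Rightarrow> bool" where
  "leaf_pair G u v \<longleftrightarrow> u \<in> verts G \<and> v \<in> verts G \<and> u \<noteq> v \<and> {u, v} \<in> edges G \<and>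
     (\<forall>e\<in>edges G. v \<in> e \<longrightarrow> e = {u, v})"

text \<open>A loop at \<open>v\<close> counts in both summands of the degree, so degree one leaves
  exactly one edge and no loop.\<close>

lemma degree_one_leaf_pair:
  assumes "is_graph G" "vertex_degree G v = 1" "{v, u} \<in> edges G"
  shows "leaf_pair G u v"
proof -
  let ?E = "{e \<in> edges G. v \<in> e}" and ?L = "{e \<in> edges G. e = {v}}"
  have fin: "finite ?E" "finite ?L" using finite_edges[OF assms(1)] by auto
  have "{v, u} \<in> ?E" using assms by auto
  then have "card ?E \<noteq> 0" using fin by auto
  then have 1: "card ?E = 1" "card ?L = 0" using assms(2) unfolding vertex_degree_def by linarith+
  then have "?L = {}" using fin card_0_eq by blast
  moreover obtain e where "?E = {e}" using 1 card_1_singletonE by blast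
  then have "?E = {{v, u}}" using \<open>{v, u} \<in> ?E\<close> by auto
  ultimately show ?thesis using assms edge_verts[OF assms(1,3)]
    by (auto simp: leaf_pair_def insert_commute)
qed

lemma K2_reduction_leaf_pair:
  assumes "is_graph G" "K2_reduction G H"
  obtains u v where "leaf_pair G u v" "H = delete_verts G {u, v}"
  using assms degree_one_leaf_pair unfolding K2_reduction_def by metis

text \<open>Reads a sequence of reductions backwards: the graph grows from the empty one by a hub
  and a leaf at a time.\<close>

lemma K2_reducible_induct [consumes 2, case_names empty step]:
  assumes "K2_reducible G" "is_graph G"
    and empty: "P empty_graph"
    and step: "\<And>G u v. is_graph G \<Longrightarrow> leaf_pair G u v \<Longrightarrow> is_graph (delete_verts G {u, v}) \<Longrightarrow>
      K2_reducible (delete_verts G {u, v}) \<Longrightarrow> P (delete_verts G {u, v}) \<Longrightarrow> P G"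
  shows "P G"
  using assms(1,2) unfolding K2_reducible_def
proof (induction rule: converse_rtranclp_induct)
  case base
  show ?case by (rule empty)
next
  case (step G H)
  obtain u v where uv: "leaf_pair G u v" "H = delete_verts G {u, v}"
    using K2_reduction_leaf_pair step.prems step.hyps(1) by metis
  show ?case
    using assms(4)[OF step.prems uv(1)] uv(2) step is_graph_delete_verts[OF step.prems, of "{u, v}"]
    unfolding K2_reducible_def by blast
qed

text \<open>A perfect matching as an involution, so that the mate of a vertex is a term. Nothing is
  demanded off the vertex set, so one function \<open>m\<close> serves all reduced graphs.\<close>

definition mated :: "'v ugraph \<Rightarrow> ('v \<Rightarrow> 'v) \<Rightarrow> bool" where
  "mated G m \<longleftrightarrow>
     (\<forall>x\<in>verts G. m x \<in> verts G \<and> m x \<noteq> x \<and> m (m x) = x \<and> {x, m x} \<in> edges G)"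

lemma mated_leaf_pair:
  assumes "mated G m" "leaf_pair G u v"
  shows "m v = u" "m u = v" "mated (delete_verts G {u, v}) m"
proof -
  show v: "m v = u" using assms unfolding mated_def leaf_pair_def
    by (metis doubleton_eq_iff insertI1)
  then show u: "m u = v" using assms unfolding mated_def leaf_pair_def by metis
  show "mated (delete_verts G {u, v}) m"
    unfolding mated_def
  proof
    fix x assume x: "x \<in> verts (delete_verts G {u, v})"
    then have "x \<in> verts G" "x \<noteq> u" "x \<noteq> v" by (auto simp: delete_verts_def)
    then have "m (m x) = x" "m x \<noteq> u" "m x \<noteq> v" using assms(1) u v unfolding mated_def by metis+
    then show "m x \<in> verts (delete_verts G {u, v}) \<and> m x \<noteq> x \<and> m (m x) = x \<and>
        {x, m x} \<in> edges (delete_verts G {u, v})"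
      using assms(1) \<open>x \<in> verts G\<close> \<open>x \<noteq> u\<close> \<open>x \<noteq> v\<close> by (auto simp: delete_verts_def mated_def)
  qed
qed

text \<open>Reduced graphs do not fill the vertex type, so inverses are functions on pairs that
  vanish off the vertex set. Symmetry carries the vanishing over to the second argument.\<close>

definition inverse_on :: "'v ugraph \<Rightarrow> ('v \<Rightarrow> 'v \<Rightarrow> real) \<Rightarrow> bool" where
  "inverse_on G B \<longleftrightarrow>
     (\<forall>x y. x \<notin> verts G \<longrightarrow> B x y = 0) \<and> (\<forall>x y. B x y = B y x) \<and>
     (\<forall>x\<in>verts G. \<forall>y\<in>verts G. (\<Sum>z\<in>verts G. real (adj G x z) * B z y) = of_bool (x = y))"

text \<open>The inverse of a matrix bordered by a leaf \<open>v\<close> and its neighbour \<open>u\<close>, by block elimination.\<close>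

definition leaf_extension ::
    "'v ugraph \<Rightarrow> 'v \<Rightarrow> 'v \<Rightarrow> ('v \<Rightarrow> 'v \<Rightarrow> real) \<Rightarrow> 'v \<Rightarrow> 'v \<Rightarrow> real" where
  "leaf_extension G u v B x y =
    (if {x, y} = {u, v} then 1
     else if x = v \<and> y = v then
       (\<Sum>h\<in>verts G - {u, v}. real (adj G u h) * (\<Sum>k\<in>verts G - {u, v}. real (adj G u k) * B h k))
         - real (adj G u u)
     else if x = v then - (\<Sum>h\<in>verts G - {u, v}. real (adj G u h) * B h y)
     else if y = v then - (\<Sum>h\<in>verts G - {u, v}. real (adj G u h) * B h x)
     else B x y)"

context
  fixes G :: "'v ugraph" and u v :: 'v and B :: "'v \<Rightarrow> 'v \<Rightarrow> real"
  assumes graph: "is_graph G" and leaf: "leaf_pair G u v"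
    and inv: "inverse_on (delete_verts G {u, v}) B"
begin

lemma leaf_ext_unfold:
  shows "leaf_extension G u v B u v = 1" "leaf_extension G u v B v u = 1"
    "y \<noteq> v \<Longrightarrow> leaf_extension G u v B u y = 0"
    "y \<noteq> v \<Longrightarrow> leaf_extension G u v B y u = 0"
    "y \<noteq> u \<Longrightarrow> y \<noteq> v \<Longrightarrow>
      leaf_extension G u v B v y = - (\<Sum>h\<in>verts G - {u, v}. real (adj G u h) * B h y)"
    "y \<noteq> u \<Longrightarrow> y \<noteq> v \<Longrightarrow>
      leaf_extension G u v B y v = - (\<Sum>h\<in>verts G - {u, v}. real (adj G u h) * B h y)"
    "x \<noteq> u \<Longrightarrow> x \<noteq> v \<Longrightarrow> y \<noteq> u \<Longrightarrow> y \<noteq> v \<Longrightarrow> leaf_extension G u v B x y = B x y"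
    "leaf_extension G u v B v v = (\<Sum>h\<in>verts G - {u, v}. real (adj G u h) *
        (\<Sum>k\<in>verts G - {u, v}. real (adj G u k) * B h k)) - real (adj G u u)"
proof -
  have Bu: "B u y = 0" for y using inv unfolding inverse_on_def delete_verts_def by simp
  have sym: "B x y = B y x" for x y using inv unfolding inverse_on_def by blast
  have uv: "u \<noteq> v" using leaf by (simp add: leaf_pair_def)
  have Bu': "B y u = 0" for y using Bu sym[of y u] by simp
  show "leaf_extension G u v B u v = 1" "leaf_extension G u v B v u = 1"
    "y \<noteq> v \<Longrightarrow> leaf_extension G u v B u y = 0"
    "y \<noteq> v \<Longrightarrow> leaf_extension G u v B y u = 0"
    "y \<noteq> u \<Longrightarrow> y \<noteq> v \<Longrightarrow>
      leaf_extension G u v B v y = - (\<Sum>h\<in>verts G - {u, v}. real (adj G u h) * B h y)"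
    "y \<noteq> u \<Longrightarrow> y \<noteq> v \<Longrightarrow>
      leaf_extension G u v B y v = - (\<Sum>h\<in>verts G - {u, v}. real (adj G u h) * B h y)"
    "x \<noteq> u \<Longrightarrow> x \<noteq> v \<Longrightarrow> y \<noteq> u \<Longrightarrow> y \<noteq> v \<Longrightarrow> leaf_extension G u v B x y = B x y"
    "leaf_extension G u v B v v = (\<Sum>h\<in>verts G - {u, v}. real (adj G u h) *
        (\<Sum>k\<in>verts G - {u, v}. real (adj G u k) * B h k)) - real (adj G u u)"
    using uv by (auto simp: leaf_extension_def doubleton_eq_iff Bu Bu' sym[of y])
qed

text \<open>With the vertices ordered \<open>u\<close>, \<open>v\<close>, rest, the matrix is
  [[a, 1, c], [1, 0, 0], [c^T, 0, A']], and its inverse is [[0, 1, 0], [1, c B c^T - a, -c B],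
  [0, -B c^T, B]], where B inverts A'. The cases check the blocks of the product.\<close>

lemma inverse_on_leaf_extension: "inverse_on G (leaf_extension G u v B)"
proof -
  let ?H = "verts G - {u, v}" and ?B = "leaf_extension G u v B"
  let ?a = "\<lambda>x y. real (adj G x y)"
  note uf = leaf_ext_unfold
  have fin: "finite ?H" and V: "verts G = insert u (insert v ?H)" and uv: "u \<noteq> v"
    using graph leaf by (auto simp: is_graph_def leaf_pair_def)
  have supp: "B x y = 0" if "x \<notin> ?H" for x y
    using inv that unfolding inverse_on_def by (auto simp: delete_verts_def)
  have sym: "B x y = B y x" for x y using inv unfolding inverse_on_def by blast
  have mult: "(\<Sum>z\<in>?H. ?a x z * B z y) = of_bool (x = y)" if "x \<in> ?H" "y \<in> ?H" for x y
  proof -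
    have "(\<Sum>z\<in>?H. ?a x z * B z y) = (\<Sum>z\<in>?H. real (adj (delete_verts G {u, v}) x z) * B z y)"
      using that by (intro sum.cong) (auto simp: adj_delete_verts)
    then show ?thesis using inv that unfolding inverse_on_def by (simp add: delete_verts_def)
  qed
  have av: "adj G v z = of_bool (z = u)" "adj G z v = of_bool (z = u)" for z
  proof -
    have "{v, z} \<in> edges G \<longleftrightarrow> z = u"
      using leaf by (auto simp: leaf_pair_def doubleton_eq_iff insert_commute)
    then show "adj G v z = of_bool (z = u)" "adj G z v = of_bool (z = u)"
      using uv by (auto simp: adj_def insert_commute)
  qed
  have expand: "(\<Sum>z\<in>verts G. ?a x z * ?B z y)
      = ?a x u * ?B u y + ?a x v * ?B v y + (\<Sum>z\<in>?H. ?a x z * ?B z y)" for x y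
    by (subst V) (use fin uv in \<open>simp add: sum.insert\<close>)
  have "?B x y = 0" if "x \<notin> verts G" for x y
  proof -
    have x: "x \<noteq> u" "x \<noteq> v" "B x y = 0" "B h x = 0" for h
      using that leaf supp sym[of h x] by (auto simp: leaf_pair_def)
    then show ?thesis using uf(4,6,7)[of x] uf(7)[of x y] by (cases "y = u"; cases "y = v") auto
  qed
  moreover have "?B x y = ?B y x" for x y
    by (auto simp: leaf_extension_def doubleton_eq_iff sym)
  moreover have "(\<Sum>z\<in>verts G. ?a x z * ?B z y) = of_bool (x = y)"
    if x: "x \<in> verts G" and y: "y \<in> verts G" for x y
  proof -
    have S1: "(\<Sum>z\<in>?H. ?a w z * ?B z y) = (\<Sum>z\<in>?H. ?a w z * B z y)" if "y \<in> ?H" for w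
      using that by (intro sum.cong) (auto simp: uf)
    have S2: "(\<Sum>z\<in>?H. ?a w z * ?B z u) = 0" for w
      by (intro sum.neutral) (auto simp: uf)
    have S3: "(\<Sum>z\<in>?H. ?a w z * ?B z v) = - (\<Sum>z\<in>?H. ?a w z * (\<Sum>h\<in>?H. ?a u h * B z h))" for w
      unfolding sum_negf[symmetric] using sym by (intro sum.cong) (auto simp: uf)
    consider "x = v" | "x = u" | "x \<in> ?H" using V x by blast
    then show ?thesis
    proof cases
      case 1
      then show ?thesis unfolding expand using uv by (cases "y = v") (auto simp: av uf)
    next
      case 2
      consider "y = v" | "y = u" | "y \<in> ?H" using V y by blast
      then show ?thesis
      proof cases
        case 1
        then show ?thesis unfolding expand using 2 uv by (simp add: av S3 uf(1,8))
      next
        case b: 2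
        then show ?thesis unfolding expand using 2 uv by (simp add: av uf S2)
      next
        case 3
        then show ?thesis unfolding expand using 2 S1[OF 3] by (auto simp: av uf)
      qed
    next
      case 3
      consider "y = v" | "y = u" | "y \<in> ?H" using V y by blast
      then show ?thesis
      proof cases
        case 1
        \<comment> \<open>Exchanging the sums lets \<open>mult\<close> collapse the inner one. What
          remains is the weight between \<open>u\<close> and \<open>x\<close>, which cancels the
          contribution of the entry 1 at (\<open>u\<close>, \<open>v\<close>).\<close>
        have "(\<Sum>z\<in>?H. ?a x z * (\<Sum>h\<in>?H. ?a u h * B z h))
          = (\<Sum>h\<in>?H. \<Sum>z\<in>?H. ?a u h * (?a x z * B z h))"
          unfolding sum_distrib_left by (subst sum.swap) (simp add: algebra_simps)
        also have "\<dots> = (\<Sum>h\<in>?H. ?a u h * of_bool (x = h))"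
          unfolding sum_distrib_left[symmetric] using mult[OF 3] by (intro sum.cong) auto
        also have "\<dots> = ?a u x" using 3 fin by (simp add: of_bool_def if_distrib sum.delta cong: if_cong)
        finally show ?thesis unfolding expand using 1 3 uv by (simp add: av S3 uf(1) adj_commute[of G x u])
      next
        case 2
        then show ?thesis unfolding expand using 3 uv by (auto simp: av uf S2)
      next
        case b: 3
        then show ?thesis unfolding expand using 3 mult[OF 3 b] S1[OF b] by (auto simp: av uf)
      qed
    qed
  qed
  ultimately show ?thesis unfolding inverse_on_def by blast
qed

text \<open>Nonzero entries stay inside components. This invariant is what keeps the neighbour sums
  of later steps short.\<close>

lemma linked_leaf_extension:
  assumes link: "\<And>x y. B x y \<noteq> 0 \<Longrightarrow> linked (delete_verts G {u, v}) x y"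
    and "leaf_extension G u v B x y \<noteq> 0"
  shows "linked G x y"
proof -
  note uf = leaf_ext_unfold
  have uv: "u \<in> verts G" "v \<in> verts G" "{u, v} \<in> edges G" "{v, u} \<in> edges G"
    using leaf by (auto simp: leaf_pair_def insert_commute)
  then have "linked G u v" "linked G v u"
    using linked_edge_trans[OF linked_refl[of v G], of u] linked_edge_trans[OF linked_refl[of u G], of v]
    by blast+
  have *: "linked G v y" if "leaf_extension G u v B v y \<noteq> 0" "y \<noteq> u" "y \<noteq> v" for y
  proof -
    have "\<exists>h\<in>verts G - {u, v}. real (adj G u h) * B h y \<noteq> 0"
    proof (rule ccontr)
      assume "\<not> ?thesis"
      then have "(\<Sum>h\<in>verts G - {u, v}. real (adj G u h) * B h y) = 0" by (intro sum.neutral) blast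
      then show False using that uf(5)[of y] by simp
    qed
    then obtain h where "adj G u h \<noteq> 0" "B h y \<noteq> 0" by auto
    then have "{u, h} \<in> edges G" "linked G h y"
      using linked_delete_verts[OF link] by (auto simp: adj_def split: if_splits)
    then show ?thesis using uv linked_edge_trans[of G h y u] linked_edge_trans[of G u y v] by blast
  qed
  consider "x = u" | "y = u" | "x = v" "y = v" | "x = v" "y \<noteq> u" "y \<noteq> v" | "y = v" "x \<noteq> u" "x \<noteq> v"
    | "x \<noteq> u" "x \<noteq> v" "y \<noteq> u" "y \<noteq> v" by blast
  then show ?thesis
  proof cases
    case 1
    then show ?thesis using assms uf(3)[of y] \<open>linked G u v\<close> by auto
  next
    case 2
    then show ?thesis using assms uf(4)[of x] \<open>linked G v u\<close> by auto
  next
    case 3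
    then show ?thesis using linked_refl[of v G] uv by simp
  next
    case 4
    then show ?thesis using * assms by auto
  next
    case 5
    then show ?thesis using *[of x] uf(5,6)[of x] assms linked_sym[of G v x] by simp
  next
    case 6
    then show ?thesis using uf(7)[of x y] linked_delete_verts[OF link[of x y]] assms by simp
  qed
qed

end

lemma sum_eq_single:
  assumes "finite S" "k \<in> S" "\<And>h. h \<in> S \<Longrightarrow> h \<noteq> k \<Longrightarrow> f h = 0"
  shows "sum f S = f k"
  using assms sum.remove[of S k f] sum.neutral[of "S - {k}" f] by auto

section \<open>Forests\<close>

text \<open>The list is cut into consecutive pairs of mates, so a nonempty one starts and ends with
  a matching edge. The edges between pairs are unconstrained.\<close>

fun alternating :: "('v \<Rightarrow> 'v) \<Rightarrow> 'v list \<Rightarrow> bool" where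
  "alternating m [] = True"
| "alternating m [x] = False"
| "alternating m (x # y # p) = (y = m x \<and> alternating m p)"

lemma alternating_even_length: "alternating m p \<Longrightarrow> even (length p)"
  by (induction m p rule: alternating.induct) auto

lemma alternating_append: "alternating m p \<Longrightarrow> alternating m (p @ q) = alternating m q"
  by (induction m p rule: alternating.induct) auto

lemma alternating_rev:
  "alternating m p \<Longrightarrow> (\<And>x. x \<in> set p \<Longrightarrow> m (m x) = x) \<Longrightarrow> alternating m (rev p)"
  by (induction m p rule: alternating.induct) (auto simp: alternating_append)

lemma alternating_mate:
  "alternating m p \<Longrightarrow> (\<And>x. x \<in> set p \<Longrightarrow> m (m x) = x) \<Longrightarrow> x \<in> set p \<Longrightarrow> m x \<in> set p"
  by (induction m p rule: alternating.induct) auto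

definition alt_path :: "'v ugraph \<Rightarrow> ('v \<Rightarrow> 'v) \<Rightarrow> 'v \<Rightarrow> 'v list \<Rightarrow> 'v \<Rightarrow> bool" where
  "alt_path G m x p y \<longleftrightarrow> path_between G x p y \<and> alternating m p"

text \<open>With k matching edges the sign is (-1)^(k-1): a single matching edge has entry 1, and
  every further pair brings in the minus sign of the leaf row in
  \<open>leaf_extension\<close>.\<close>

definition alt_sign :: "'v list \<Rightarrow> real" where
  "alt_sign p = - ((-1) ^ (length p div 2))"

lemma alt_sign_cases: "alt_sign p = 1 \<or> alt_sign p = -1"
  unfolding alt_sign_def by (cases "even (length p div 2)") auto

lemma alt_sign_Cons2: "alt_sign (x # y # p) = - alt_sign p"
  by (simp add: alt_sign_def)

lemma alt_sign_rev: "alt_sign (rev p) = alt_sign p"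
  by (simp add: alt_sign_def)

lemma alt_path_linked: "alt_path G m x p y \<Longrightarrow> linked G x y"
  unfolding alt_path_def linked_def by metis

lemma alt_path_rev: "alt_path G m x p y \<Longrightarrow> mated G m \<Longrightarrow> alt_path G m y (rev p) x"
  unfolding alt_path_def
  by (metis alternating_rev mated_def path_between_def path_between_rev subsetD)

lemma alt_path_neq: "alt_path G m x p y \<Longrightarrow> x \<noteq> y"
  unfolding alt_path_def path_between_def
  by (cases p; cases "tl p") (auto split: if_splits)

lemma sum_eq_pair:
  assumes "finite S" "k \<in> S" "l \<in> S" "k \<noteq> l" "\<And>h. h \<in> S \<Longrightarrow> h \<noteq> k \<Longrightarrow> h \<noteq> l \<Longrightarrow> f h = 0"
  shows "sum f S = f k + f l"
proof -
  have "sum f S = f k + sum f (S - {k})" using assms by (simp add: sum.remove)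
  also have "sum f (S - {k}) = f l" using assms by (intro sum_eq_single) auto
  finally show ?thesis .
qed

text \<open>Makes at most one neighbour of \<open>u\<close> contribute to a neighbour sum, provided
  nonzero entries stay within components, and keeps a loop term out of the diagonal entry of the
  leaf.\<close>

definition separated :: "'v ugraph \<Rightarrow> 'v \<Rightarrow> 'v \<Rightarrow> bool" where
  "separated G u v \<longleftrightarrow> {u} \<notin> edges G \<and>
     (\<forall>h k. {u, h} \<in> edges G \<longrightarrow> {u, k} \<in> edges G \<longrightarrow> linked (delete_verts G {u, v}) h k \<longrightarrow> h = k)"

section \<open>Neighbour sums at the hub\<close>

context
  fixes G :: "'v ugraph" and u v :: 'v and B :: "'v \<Rightarrow> 'v \<Rightarrow> real"
  assumes graph: "is_graph G" and leaf: "leaf_pair G u v"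
    and inv: "inverse_on (delete_verts G {u, v}) B"
    and link: "\<And>x y. B x y \<noteq> 0 \<Longrightarrow> linked (delete_verts G {u, v}) x y"
begin

lemma neighbour_sum_nonzero:
  assumes "(\<Sum>h\<in>verts G - {u, v}. real (adj G u h) * f h) \<noteq> 0"
  obtains h where "h \<in> verts G - {u, v}" "{u, h} \<in> edges G" "f h \<noteq> 0"
proof -
  have "\<exists>h\<in>verts G - {u, v}. real (adj G u h) * f h \<noteq> 0"
  proof (rule ccontr)
    assume "\<not> ?thesis"
    then have "(\<Sum>h\<in>verts G - {u, v}. real (adj G u h) * f h) = 0" by (intro sum.neutral) blast
    then show False using assms by simp
  qed
  then obtain h where "h \<in> verts G - {u, v}" "adj G u h \<noteq> 0" "f h \<noteq> 0" by auto
  moreover from this have "{u, h} \<in> edges G" by (simp add: adj_def split: if_splits)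
  ultimately show ?thesis using that by blast
qed

lemma neighbour_sum_single:
  assumes "k \<in> verts G - {u, v}" "{u, k} \<in> edges G"
    and "\<And>h. h \<in> verts G - {u, v} \<Longrightarrow> {u, h} \<in> edges G \<Longrightarrow> f h \<noteq> 0 \<Longrightarrow> h = k"
  shows "(\<Sum>h\<in>verts G - {u, v}. real (adj G u h) * f h) = f k"
proof -
  have "(\<Sum>h\<in>verts G - {u, v}. real (adj G u h) * f h) = real (adj G u k) * f k"
  proof (rule sum_eq_single[OF _ assms(1)])
    show "finite (verts G - {u, v})" using graph by (simp add: is_graph_def)
    fix h assume "h \<in> verts G - {u, v}" "h \<noteq> k"
    then have "{u, h} \<notin> edges G \<or> f h = 0" using assms(3)[of h] by blast
    then show "real (adj G u h) * f h = 0" by (auto simp: adj_def)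
  qed
  moreover have "adj G u k = 1" using assms(1,2) by (auto simp: adj_def)
  ultimately show ?thesis by simp
qed

text \<open>A nonzero \<open>B h y\<close> puts \<open>h\<close> into the component of
  \<open>y\<close>, where \<open>k\<close> is the only neighbour of \<open>u\<close>.\<close>

lemma separated_neighbour_sum:
  assumes "separated G u v" "k \<in> verts G - {u, v}" "{u, k} \<in> edges G"
    "linked (delete_verts G {u, v}) k y"
  shows "(\<Sum>h\<in>verts G - {u, v}. real (adj G u h) * B h y) = B k y"
proof (rule neighbour_sum_single)
  fix h assume h: "h \<in> verts G - {u, v}" "{u, h} \<in> edges G" "B h y \<noteq> 0"
  then have "linked (delete_verts G {u, v}) h k"
    using link[OF h(3)] linked_sym[OF assms(4)] linked_trans[of "delete_verts G {u, v}" h y k] by simp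
  then show "h = k" using assms h unfolding separated_def by blast
qed (use assms in auto)

text \<open>A nonzero term \<open>B h k\<close> of the quadratic form needs linked neighbours, hence
  \<open>h = k\<close>, but the diagonal of \<open>B\<close> is zero.\<close>

lemma separated_leaf_extension_leaf:
  assumes "separated G u v" "\<And>x. B x x = 0"
  shows "leaf_extension G u v B v v = 0"
proof -
  have "(\<Sum>k\<in>verts G - {u, v}. real (adj G u k) * B h k) = 0" if h: "{u, h} \<in> edges G" for h
  proof (rule ccontr)
    assume "(\<Sum>k\<in>verts G - {u, v}. real (adj G u k) * B h k) \<noteq> 0"
    then obtain k where "{u, k} \<in> edges G" "B h k \<noteq> 0" using neighbour_sum_nonzero[of "B h"] by blast
    then have "h = k" using link[of h k] assms(1) h unfolding separated_def by blast
    then show False using \<open>B h k \<noteq> 0\<close> assms(2) by simp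
  qed
  then have "(\<Sum>h\<in>verts G - {u, v}. real (adj G u h) *
        (\<Sum>k\<in>verts G - {u, v}. real (adj G u k) * B h k)) = 0"
    by (intro sum.neutral) (simp add: adj_def)
  moreover have "adj G u u = 0" using assms by (auto simp: separated_def adj_def)
  ultimately show ?thesis by (simp add: leaf_ext_unfold(8)[OF graph leaf inv])
qed

text \<open>Every new entry is 0, 1 or the negative of a single old one. This handles reductions
  away from the cycle.\<close>

lemma sign_leaf_extension:
  assumes sep: "separated G u v" and diag: "\<And>x. B x x = 0"
    and sign: "\<And>x y. B x y \<in> {-1, 0, 1}"
  shows "leaf_extension G u v B x y \<in> {-1, 0, 1}" "leaf_extension G u v B x x = 0"
proof -
  note uf = leaf_ext_unfold[OF graph leaf inv]
  have uv: "u \<noteq> v" using leaf by (simp add: leaf_pair_def)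
  have S: "(\<Sum>h\<in>verts G - {u, v}. real (adj G u h) * B h y) \<in> {-1, 0, 1}" for y
  proof (cases "(\<Sum>h\<in>verts G - {u, v}. real (adj G u h) * B h y) = 0")
    case False
    then obtain h where h: "h \<in> verts G - {u, v}" "{u, h} \<in> edges G" "B h y \<noteq> 0"
      using neighbour_sum_nonzero[of "\<lambda>h. B h y"] by blast
    then show ?thesis using separated_neighbour_sum[OF sep h(1,2) link[OF h(3)]] sign[of h y] by simp
  qed simp
  have vv: "leaf_extension G u v B v v = 0" using separated_leaf_extension_leaf sep diag by blast
  show "leaf_extension G u v B x x = 0"
  proof -
    consider "x = u" | "x = v" | "x \<noteq> u" "x \<noteq> v" by blast
    then show ?thesis using uf(3)[of u] uf(7)[of x x] vv diag uv by cases auto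
  qed
  consider "x = u" "y = v" | "x = u" "y \<noteq> v" | "y = u" "x = v" | "y = u" "x \<noteq> v" | "x = v" "y = v"
    | "x = v" "y \<noteq> u" "y \<noteq> v" | "y = v" "x \<noteq> u" "x \<noteq> v" | "x \<noteq> u" "x \<noteq> v" "y \<noteq> u" "y \<noteq> v" by blast
  then show "leaf_extension G u v B x y \<in> {-1, 0, 1}"
  proof cases
    case 1 then show ?thesis using uf(1) by simp
  next
    case 2 then show ?thesis using uf(3) by simp
  next
    case 3 then show ?thesis using uf(2) by simp
  next
    case 4 then show ?thesis using uf(4) by simp
  next
    case 5 then show ?thesis using vv by simp
  next
    case 6 then show ?thesis using uf(5)[of y] S[of y] by auto
  next
    case 7 then show ?thesis using uf(6)[of x] S[of x] by auto
  next
    case 8 then show ?thesis using uf(7)[of x y] sign[of x y] by simp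
  qed
qed

end

text \<open>In the interior of a path the leaf would have its hub on both sides.\<close>

lemma path_leaf_end:
  assumes "path_between G x p y" "leaf_pair G u v" "v \<in> set p"
  shows "x = v \<or> y = v"
proof (rule ccontr)
  assume n: "\<not> ?thesis"
  obtain as bs where p: "p = as @ v # bs" using assms(3) by (meson split_list)
  then have ne: "as \<noteq> []" "bs \<noteq> []" using n assms(1) by (auto simp: path_between_def)
  then have "{last as, v} \<in> edges G" "{v, hd bs} \<in> edges G"
    using assms(1) p by (auto simp: path_between_def path_edges_append path_edges_Cons)
  then have "last as = u" "hd bs = u"
    using assms(2) by (auto simp: leaf_pair_def doubleton_eq_iff)
  then have "u \<in> set as" "u \<in> set bs" using ne last_in_set hd_in_set by fastforce+
  then show False using assms(1) p by (auto simp: path_between_def)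
qed

section \<open>Alternating paths under a reduction\<close>

context
  fixes G :: "'v ugraph" and u v :: 'v and m :: "'v \<Rightarrow> 'v"
  assumes leaf: "leaf_pair G u v" and mated: "mated G m"
begin

text \<open>The leaf cannot be interior to the path, and the vertices of an alternating path are
  closed under \<open>m\<close>, so the hub, being the mate of the leaf, is missing too.\<close>

lemma alt_path_avoiding_leaf:
  assumes "alt_path G m x p y" "x \<notin> {u, v}" "y \<notin> {u, v}"
  shows "alt_path (delete_verts G {u, v}) m x p y"
proof -
  have p: "path_between G x p y" "alternating m p" using assms by (auto simp: alt_path_def)
  then have v: "v \<notin> set p" using path_leaf_end leaf assms by fastforce
  have "m (m x) = x" if "x \<in> set p" for x
    using that p mated by (auto simp: path_between_def mated_def)
  then have "u \<notin> set p" using v alternating_mate[OF p(2), of u] mated_leaf_pair[OF mated leaf] by auto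
  then show ?thesis using p v path_between_delete[OF p(1), of "{u, v}"] by (auto simp: alt_path_def)
qed

text \<open>An alternating path must leave \<open>v\<close> along its matching edge; dropping this
  first pair gives an alternating path of the reduced graph.\<close>

lemma alt_path_from_leaf:
  assumes "alt_path G m v p y" "p \<noteq> [v, u]"
  obtains h q where "p = v # u # q" "alt_path (delete_verts G {u, v}) m h q y" "{u, h} \<in> edges G"
    "h \<in> verts G - {u, v}"
proof -
  have p: "path_between G v p y" "alternating m p" using assms by (auto simp: alt_path_def)
  then obtain w q where "p = v # w # q" by (cases p; cases "tl p") (auto simp: path_between_def)
  then have pq: "p = v # u # q" using p mated_leaf_pair[OF mated leaf] by auto
  then have q: "q \<noteq> []" using assms by auto
  have q1: "path_between G (hd q) q y" "{u, hd q} \<in> edges G" "alternating m q"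
    "set q \<inter> {u, v} = {}"
    using path_between_suffix[of G v "[v, u]" q y] p q pq
    by (auto simp: path_between_def path_edges_Cons)
  then have "alt_path (delete_verts G {u, v}) m (hd q) q y"
    using path_between_delete[OF q1(1,4)] by (simp add: alt_path_def)
  moreover have "hd q \<in> verts G - {u, v}"
    using q1 q hd_in_set[OF q] path_between_verts[OF q1(1)] by blast
  ultimately show ?thesis using that[OF pq] q1(2) by blast
qed

lemma alt_path_from_hub:
  assumes "alt_path G m u p y"
  shows "p = [u, v]" "y = v"
proof -
  have p: "path_between G u p y" "alternating m p" using assms by (auto simp: alt_path_def)
  then obtain w q where "p = u # w # q" by (cases p; cases "tl p") (auto simp: path_between_def)
  then have pq: "p = u # v # q" using p mated_leaf_pair[OF mated leaf] by auto
  have "y = v" using path_leaf_end[OF p(1) leaf] pq leaf by (auto simp: leaf_pair_def)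
  then show "y = v" "p = [u, v]" using p(1) pq
    by (auto simp: path_between_def split: if_splits)
qed

lemma alt_path_delete:
  "alt_path (delete_verts G {u, v}) m x p y \<Longrightarrow> alt_path G m x p y"
  unfolding alt_path_def by (auto intro: path_between_mono[OF _ subgraph_delete_verts])

lemma alt_path_hub_leaf: "alt_path G m u [u, v] v"
  using leaf mated_leaf_pair[OF mated leaf]
  by (auto simp: alt_path_def path_between_def leaf_pair_def)

lemma alt_path_extend:
  assumes "alt_path (delete_verts G {u, v}) m h q y" "{u, h} \<in> edges G"
  shows "alt_path G m v (v # u # q) y"
proof -
  have "u \<notin> set q" "v \<notin> set q" "path_between G h q y" "alternating m q"
    using assms(1) alt_path_delete[OF assms(1)]
    by (auto simp: alt_path_def path_between_def delete_verts_def)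
  then have "path_between G u (u # q) y"
    using path_between_Cons[of G h q y u] leaf assms(2) by (auto simp: leaf_pair_def)
  then have "path_between G v (v # u # q) y"
    using path_between_Cons[of G u "u # q" y v] leaf \<open>v \<notin> set q\<close>
    by (auto simp: leaf_pair_def insert_commute)
  then show ?thesis using \<open>alternating m q\<close> mated_leaf_pair[OF mated leaf] by (simp add: alt_path_def)
qed

end

lemma acyclic_separated:
  assumes "\<not> has_cycle G" "is_graph G" "leaf_pair G u v"
  shows "separated G u v"
proof -
  have "u \<in> verts G" using assms by (simp add: leaf_pair_def)
  then have "{u} \<notin> edges G" using loop_is_cycle[of u G] assms(1) unfolding has_cycle_def by blast
  then show ?thesis unfolding separated_def
    using acyclic_linked_neighbours[OF assms(1), of "{u, v}" _ _ u] \<open>u \<in> verts G\<close> by blast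
qed

text \<open>In a forest two vertices are joined by at most one path, so this describes the inverse
  completely in terms of the matching.\<close>

definition alt_inverse :: "'v ugraph \<Rightarrow> ('v \<Rightarrow> 'v) \<Rightarrow> ('v \<Rightarrow> 'v \<Rightarrow> real) \<Rightarrow> bool" where
  "alt_inverse G m B \<longleftrightarrow> inverse_on G B \<and>
     (\<forall>x p y. alt_path G m x p y \<longrightarrow> B x y = alt_sign p) \<and>
     (\<forall>x y. B x y \<noteq> 0 \<longrightarrow> (\<exists>p. alt_path G m x p y))"

lemma alt_inverse_linked: "alt_inverse G m B \<Longrightarrow> B x y \<noteq> 0 \<Longrightarrow> linked G x y"
  unfolding alt_inverse_def using alt_path_linked by metis

lemma alt_inverse_diag: "alt_inverse G m B \<Longrightarrow> B x x = 0"
  unfolding alt_inverse_def using alt_path_neq by metis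

lemma alt_inverse_sign: "alt_inverse G m B \<Longrightarrow> B x y \<in> {-1, 0, 1}"
  unfolding alt_inverse_def using alt_sign_cases by (metis insert_iff)

text \<open>The leaf row has the entry \<open>- B h y\<close>, and prepending \<open>v\<close>,
  \<open>u\<close> to an alternating path from \<open>h\<close> adds one pair, which flips the sign
  as well. Separation ensures that only one \<open>h\<close> contributes.\<close>

lemma alt_inverse_leaf_extension:
  assumes graph: "is_graph G" and leaf: "leaf_pair G u v" and mated: "mated G m"
    and sep: "separated G u v" and alt: "alt_inverse (delete_verts G {u, v}) m B"
  shows "alt_inverse G m (leaf_extension G u v B)"
proof -
  let ?H = "delete_verts G {u, v}" and ?B = "leaf_extension G u v B"
  have inv: "inverse_on ?H B"
    and val: "\<And>x p y. alt_path ?H m x p y \<Longrightarrow> B x y = alt_sign p"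
    and ex: "\<And>x y. B x y \<noteq> 0 \<Longrightarrow> \<exists>p. alt_path ?H m x p y"
    using alt by (auto simp: alt_inverse_def)
  have link: "\<And>x y. B x y \<noteq> 0 \<Longrightarrow> linked ?H x y" using alt_inverse_linked[OF alt] .
  note uf = leaf_ext_unfold[OF graph leaf inv]
  have inv': "inverse_on G ?B" using inverse_on_leaf_extension[OF graph leaf inv] .
  then have sym: "?B x y = ?B y x" for x y unfolding inverse_on_def by blast
  have vv: "?B v v = 0"
    using separated_leaf_extension_leaf[OF graph leaf inv link sep] alt_inverse_diag[OF alt] by simp
  have uv: "u \<noteq> v" using leaf by (simp add: leaf_pair_def)
  have from_v: "?B v y = alt_sign p" if p: "alt_path G m v p y" for p y
  proof (cases "p = [v, u]")
    case True
    then have "y = u" using p by (auto simp: alt_path_def path_between_def)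
    then show ?thesis using uf(2) True by (simp add: alt_sign_def)
  next
    case False
    then obtain h q where q: "p = v # u # q" "alt_path ?H m h q y" "{u, h} \<in> edges G"
      "h \<in> verts G - {u, v}"
      using alt_path_from_leaf[OF leaf mated p] by blast
    then have "y \<noteq> u" "y \<noteq> v"
      using path_between_verts[of ?H h q y] by (auto simp: alt_path_def delete_verts_def)
    then have "?B v y = - B h y"
      using uf(5) separated_neighbour_sum[OF graph leaf inv link sep q(4,3) alt_path_linked[OF q(2)]]
      by simp
    then show ?thesis using val[OF q(2)] q(1) by (simp add: alt_sign_Cons2)
  qed
  have from_u: "?B u y = alt_sign p" if p: "alt_path G m u p y" for p y
    using alt_path_from_hub[OF leaf mated p] uf(1) by (simp add: alt_sign_def)
  have to_uv: "?B x y = alt_sign p" if p: "alt_path G m x p y" and y: "y = u \<or> y = v" for x p y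
    using from_u[of "rev p" x] from_v[of "rev p" x] alt_path_rev[OF p mated] y sym[of x y]
    by (auto simp: alt_sign_rev)
  have "?B x y = alt_sign p" if p: "alt_path G m x p y" for x p y
  proof (cases "x = u \<or> x = v \<or> y = u \<or> y = v")
    case True
    then show ?thesis using from_u from_v to_uv p by blast
  next
    case False
    then show ?thesis using alt_path_avoiding_leaf[OF leaf mated p] val uf(7)[of x y] by simp
  qed
  moreover have "\<exists>p. alt_path G m x p y" if nz: "?B x y \<noteq> 0" for x y
  proof -
    have v1: "\<exists>p. alt_path G m v p y" if "?B v y \<noteq> 0" "y \<noteq> u" "y \<noteq> v" for y
    proof -
      have "(\<Sum>h\<in>verts G - {u, v}. real (adj G u h) * B h y) \<noteq> 0" using uf(5)[of y] that by simp
      then obtain h where "{u, h} \<in> edges G" "B h y \<noteq> 0"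
        using neighbour_sum_nonzero[OF graph leaf inv link, of "\<lambda>h. B h y"] by blast
      then show ?thesis using ex[of h y] alt_path_extend[OF leaf mated, of h _ y] by blast
    qed
    consider "x = u" | "y = u" | "x = v" "y = v" | "x = v" "y \<noteq> u" "y \<noteq> v"
      | "y = v" "x \<noteq> u" "x \<noteq> v" | "x \<noteq> u" "x \<noteq> v" "y \<noteq> u" "y \<noteq> v" by blast
    then show ?thesis
    proof cases
      case 1
      then show ?thesis using nz uf(3)[of y] alt_path_hub_leaf[OF leaf mated] by blast
    next
      case 2
      then show ?thesis
        using nz uf(4)[of x] alt_path_rev[OF alt_path_hub_leaf[OF leaf mated] mated] by blast
    next
      case 3
      then show ?thesis using nz vv by simp
    next
      case 4
      then show ?thesis using nz v1[of y] by simp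
    next
      case 5
      then show ?thesis using nz v1[of x] sym[of v x] alt_path_rev[OF _ mated] by metis
    next
      case 6
      then show ?thesis
        using nz uf(7)[of x y] ex[of x y] alt_path_delete[OF leaf mated, of x _ y] by auto
    qed
  qed
  ultimately show ?thesis using inv' unfolding alt_inverse_def by blast
qed

lemma has_cycle_delete_verts: "has_cycle (delete_verts G S) \<Longrightarrow> has_cycle G"
  using has_cycle_mono[OF _ subgraph_delete_verts] .

lemma forest_alt_inverse:
  assumes "K2_reducible G" "is_graph G" "\<not> has_cycle G" "mated G m"
  shows "\<exists>B. alt_inverse G m B"
  using assms
proof (induction rule: K2_reducible_induct)
  case empty
  have "inverse_on empty_graph (\<lambda>x y. 0)" by (simp add: inverse_on_def empty_graph_def)
  then have "alt_inverse empty_graph m (\<lambda>x y. 0)"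
    by (auto simp: alt_inverse_def alt_path_def path_between_def empty_graph_def)
  then show ?case by blast
next
  case (step G u v)
  then obtain B where "alt_inverse (delete_verts G {u, v}) m B"
    using has_cycle_delete_verts mated_leaf_pair(3) by metis
  then show ?case using alt_inverse_leaf_extension step acyclic_separated by metis
qed

text \<open>The chord would be a second path from \<open>a\<close> to \<open>b\<close>, besides the
  stretch of the given path through \<open>y\<close>.\<close>

lemma no_chord:
  assumes "\<not> has_cycle H" "path_between H x (as @ y # bs) z" "a \<in> set as" "b \<in> set bs"
  shows "{a, b} \<notin> edges H"
proof
  assume e: "{a, b} \<in> edges H"
  obtain a1 a2 b1 b2 where s: "as = a1 @ a # a2" "bs = b1 @ b # b2"
    using assms by (meson split_list)
  have "path_between H a ((a # a2 @ y # b1 @ [b]) @ b2) z"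
    using path_between_suffix[of H x a1 "a # a2 @ y # b1 @ b # b2" z] assms(2) s by simp
  then have p: "path_between H a (a # a2 @ y # b1 @ [b]) b"
    using path_between_prefix[of H a "a # a2 @ y # b1 @ [b]" b2 z] by simp
  moreover from p have "path_between H a [a, b] b" using e by (auto simp: path_between_def)
  ultimately have "a # a2 @ y # b1 @ [b] = [a, b]" by (rule acyclic_path_unique[OF assms(1)])
  then show False by (cases a2) auto
qed

text \<open>The mate of the first vertex lies on the path and can only be the second vertex, as
  otherwise the matching edge would be a chord. Removing this pair leaves a shorter
  instance.\<close>

lemma mated_path_alternating:
  assumes "\<not> has_cycle H" "mated H m" "path_between H x p y" "\<forall>z\<in>set p. m z \<in> set p"
  shows "alternating m p"
  using assms(3,4)
proof (induction "length p" arbitrary: x p rule: less_induct)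
  case less
  then obtain r where p: "p = x # r" by (cases p) (auto simp: path_between_def)
  have mate: "m z \<noteq> z \<and> m (m z) = z \<and> {z, m z} \<in> edges H" if "z \<in> set p" for z
    using that less.prems(1) assms(2) by (auto simp: path_between_def mated_def)
  then have "m x \<in> set r" using less.prems(2) p by auto
  then obtain as bs where r: "r = as @ m x # bs" by (meson split_list)
  have "as = []"
  proof (rule ccontr)
    assume "as \<noteq> []"
    then obtain a as' where "as = a # as'" by (cases as) auto
    then have "path_between H x ([x] @ a # (as' @ m x # bs)) y" using less.prems(1) p r by simp
    from no_chord[OF assms(1) this, of x "m x"] mate[of x] p show False by simp
  qed
  then have p: "p = x # m x # bs" using p r by simp
  have "alternating m bs"
  proof (cases "bs = []")
    case False
    have "m z \<in> set bs" if z: "z \<in> set bs" for z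
    proof -
      have "m z \<in> set p" "m (m z) = z" using less.prems(2) z p mate by auto
      moreover have "z \<noteq> x" "z \<noteq> m x" using z less.prems(1) p by (auto simp: path_between_def)
      ultimately show ?thesis using p mate[of x] by auto
    qed
    then show ?thesis
      using less.hyps[of bs "hd bs"] path_between_suffix[of H x "[x, m x]" bs y] less.prems(1) p False
      by simp
  qed simp
  then show ?case using p by simp
qed

section \<open>The cycle\<close>

lemma cycle_neighbours:
  assumes "distinct (u # ys)" "ys \<noteq> []"
  shows "{u, x} \<in> edges (cycle_of (u # ys)) \<longleftrightarrow> x = hd ys \<or> x = last ys"
proof -
  have "{u, x} \<notin> path_edges ys" using path_edges_subset_set[of "{u, x}" ys] assms(1) by auto
  then show ?thesis using assms by (auto simp: path_edges_Cons doubleton_eq_iff)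
qed

text \<open>A cycle vertex carries a loop or has two distinct neighbours on the cycle, a leaf
  neither.\<close>

lemma leaf_not_in_cycle:
  assumes "leaf_pair G u v" "is_cycle Q" "subgraph_of Q G"
  shows "v \<notin> verts Q"
proof
  assume v: "v \<in> verts Q"
  obtain zs where zs: "distinct (v # zs)" "length (v # zs) \<noteq> 2" "Q = cycle_of (v # zs)"
    by (rule cycle_through_vertex[OF assms(2) v])
  have nb: "x = u" if "{v, x} \<in> edges Q" for x
  proof -
    have "{v, x} \<in> edges G" using that assms(3) by (auto simp: subgraph_of_def)
    then have "{v, x} = {u, v}" using assms(1) unfolding leaf_pair_def by simp
    then show ?thesis by (auto simp: doubleton_eq_iff)
  qed
  show False
  proof (cases zs)
    case Nil
    then have "{v, v} \<in> edges Q" using zs(3) by simp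
    then have "v = u" by (rule nb)
    then show False using assms(1) by (simp add: leaf_pair_def)
  next
    case (Cons z r)
    then have ne: "zs \<noteq> []" by simp
    have "z = u" if "z = hd zs \<or> z = last zs" for z
      using that by (intro nb) (simp only: zs(3) cycle_neighbours[OF zs(1) ne])
    then have "hd zs = u" "last zs = u" by simp_all
    moreover have "r \<noteq> []" using zs(2) Cons by auto
    ultimately have "z = u" "u \<in> set r" using Cons last_in_set[of r] by auto
    then show False using zs(1) Cons by simp
  qed
qed

text \<open>For the vertex set of a cycle these are the attachments of its pegs.\<close>

definition exposed :: "('v \<Rightarrow> 'v) \<Rightarrow> 'v set \<Rightarrow> 'v set" where
  "exposed m S = {x \<in> S. m x \<notin> S}"

text \<open>The criterion in terms of the cycle length alone; \<open>two_exposed_arcs\<close>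
  translates it back to arcs.\<close>

definition sign_good :: "('v \<Rightarrow> 'v) \<Rightarrow> 'v set \<Rightarrow> bool" where
  "sign_good m S \<longleftrightarrow>
     card (exposed m S) \<ge> 2 \<and> (card (exposed m S) = 2 \<longrightarrow> 4 dvd card S)"

lemma alternating_append_even:
  "alternating m (p @ q) \<Longrightarrow> even (length p) \<Longrightarrow> alternating m p \<and> alternating m q"
  by (induction m p rule: alternating.induct) auto

text \<open>No matching edge can jump over \<open>y\<close>, and \<open>y\<close> itself is matched
  off the path, so each side is matched within itself. The first side is reversed so that both are
  read outwards from \<open>y\<close>.\<close>

lemma mated_path_split:
  assumes "\<not> has_cycle H" "mated H m" "path_between H x (as @ y # bs) z"
    and "\<forall>w\<in>set as \<union> set bs. m w \<in> set (as @ y # bs)" "m y \<notin> set (as @ y # bs)"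
  shows "alternating m (rev as)" "alternating m bs"
proof -
  have mm: "m (m w) = w" "{w, m w} \<in> edges H" if "w \<in> set (as @ y # bs)" for w
    using that assms(2,3) by (auto simp: path_between_def mated_def)
  have ne: "m w \<noteq> y" if "w \<in> set as \<union> set bs" for w
    using that mm(1)[of w] assms(5) by auto
  have as: "m w \<in> set as" if "w \<in> set as" for w
  proof -
    have "m w \<notin> set bs" using no_chord[OF assms(1,3) that] mm(2)[of w] that by auto
    then show ?thesis using assms(4) ne[of w] that by auto
  qed
  have bs: "m w \<in> set bs" if "w \<in> set bs" for w
  proof -
    have "m w \<notin> set as"
      using no_chord[OF assms(1,3) _ that, of "m w"] mm(2)[of w] that by (auto simp: insert_commute)
    then show ?thesis using assms(4) ne[of w] that by auto
  qed
  show "alternating m (rev as)"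
  proof (cases "as = []")
    case False
    then have "path_between H x as (last as)" using path_between_prefix[OF assms(3)] by simp
    from path_between_rev[OF this] show ?thesis
      using as by (intro mated_path_alternating[OF assms(1,2)]) auto
  qed simp
  show "alternating m bs"
  proof (cases "bs = []")
    case False
    then have "path_between H (hd bs) bs z"
      using assms(3) path_between_suffix[of H x "as @ [y]" bs z] by simp
    then show ?thesis using bs by (intro mated_path_alternating[OF assms(1,2)]) auto
  qed simp
qed

lemma path_between_append:
  assumes "path_between H x p y" "path_between H z q w" "{y, z} \<in> edges H" "set p \<inter> set q = {}"
  shows "path_between H x (p @ q) w"
  using assms by (auto simp: path_between_def path_edges_append)

text \<open>In a forest the paths from \<open>x\<close> to the two ends of \<open>ys\<close> first
  meet \<open>ys\<close> at a common vertex \<open>y\<close> and branch there.\<close>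

lemma path_to_both_ends:
  assumes "\<not> has_cycle H" "path_between H a ys b" "path_between H x p a" "path_between H x q b"
  obtains c as y bs where "ys = as @ y # bs" "p = c @ y # rev as" "q = c @ y # bs"
    "set c \<inter> set ys = {}"
proof -
  have "a \<in> set p" "a \<in> set ys"
    using assms(2,3) last_in_set[of p] hd_in_set[of ys] by (auto simp: path_between_def)
  then obtain c y r where p: "p = c @ y # r" "y \<in> set ys" "\<forall>z\<in>set c. z \<notin> set ys"
    using split_list_first_prop[of p "\<lambda>z. z \<in> set ys"] by metis
  then obtain as bs where ys: "ys = as @ y # bs" by (meson split_list)
  have sub: "path_between H y (y # bs) b"
    using path_between_suffix[of H a as "y # bs" b] assms(2) ys by simp
  have "path_between H a (as @ [y]) y"
    using path_between_prefix[of H a "as @ [y]" bs b] assms(2) ys by simp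
  from path_between_rev[OF this] have sua: "path_between H y (y # rev as) a" by simp
  \<comment> \<open>Here \<open>y\<close> is where \<open>p\<close> first meets \<open>ys\<close>.
    Following \<open>ys\<close> from there to either end gives a path, which uniqueness identifies
    with \<open>p\<close> or \<open>q\<close>.\<close>
  have join: "path_between H x (c @ y # t) w"
    if t: "path_between H y (y # t) w" "set (y # t) \<subseteq> set ys" for t w
  proof (cases "c = []")
    case True
    then have "x = y" using assms(3) p by (auto simp: path_between_def)
    then show ?thesis using t True by simp
  next
    case False
    have "path_between H x (c @ [y]) y"
      using path_between_prefix[of H x "c @ [y]" r a] assms(3) p by simp
    then have "path_between H x c (last c)" "{last c, y} \<in> edges H"
      using path_between_prefix[of H x c "[y]" y] False by (auto simp: path_between_def path_edges_append)
    moreover have "set c \<inter> set (y # t) = {}" using t(2) p(3) by auto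
    ultimately show ?thesis using path_between_append[of H x c "last c" y "y # t" w] t(1) by simp
  qed
  have "p = c @ y # rev as"
    using acyclic_path_unique[OF assms(1) assms(3) join[OF sua]] ys by auto
  moreover have "q = c @ y # bs"
    using acyclic_path_unique[OF assms(1) assms(4) join[OF sub]] ys by auto
  ultimately show ?thesis using that ys p(3) by blast
qed

section \<open>The reduction whose hub lies on the cycle\<close>

context
  fixes G :: "'v ugraph" and u v :: 'v and ys :: "'v list" and m :: "'v \<Rightarrow> 'v"
    and B :: "'v \<Rightarrow> 'v \<Rightarrow> real"
  assumes graph: "is_graph G" and leaf: "leaf_pair G u v" and mated: "mated G m"
    and dist: "distinct (u # ys)" and len: "length (u # ys) \<noteq> 2"
    and sub: "subgraph_of (cycle_of (u # ys)) G"
    and uniq: "\<And>C. is_cycle C \<Longrightarrow> subgraph_of C G \<Longrightarrow> C = cycle_of (u # ys)"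
    and alt: "alt_inverse (delete_verts G {u, v}) m B"
begin

lemma cycle: "is_cycle (cycle_of (u # ys))"
  using dist len unfolding is_cycle_iff by blast

lemma leaf_not_in: "v \<notin> set (u # ys)"
  using leaf_not_in_cycle[OF leaf cycle sub] by simp

text \<open>A connection avoiding \<open>u\<close> closes up to a cycle through \<open>u\<close>,
  which must be the given one; it remains to compare the neighbours of \<open>u\<close> on
  both.\<close>

lemma neighbours_linked:
  assumes "{u, h} \<in> edges G" "{u, k} \<in> edges G" "linked (delete_verts G {u, v}) h k" "h \<noteq> k"
  shows "ys \<noteq> []" "{h, k} = {hd ys, last ys}"
proof -
  obtain p where p: "path_between (delete_verts G {u, v}) h p k" using assms unfolding linked_def by blast
  then have p': "path_between G h p k" and "u \<notin> set p"
    using path_between_mono[OF p subgraph_delete_verts] by (auto simp: path_between_def delete_verts_def)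
  moreover have "u \<in> verts G" using leaf by (simp add: leaf_pair_def)
  ultimately have "cycle_of (u # p) = cycle_of (u # ys)"
    using path_closes_to_cycle[of G h p k u] uniq assms by blast
  moreover have pn: "p \<noteq> []" "distinct (u # p)" "hd p = h" "last p = k"
    using p \<open>u \<notin> set p\<close> by (auto simp: path_between_def)
  ultimately have vs: "set (u # p) = set (u # ys)"
    and es: "edges (cycle_of (u # p)) = edges (cycle_of (u # ys))"
    by (metis cycle_of_sel(1), simp)
  show ys: "ys \<noteq> []" using vs pn by (cases p) auto
  have "x = hd p \<or> x = last p \<longleftrightarrow> x = hd ys \<or> x = last ys" for x
    unfolding cycle_neighbours[OF pn(2,1), symmetric] cycle_neighbours[OF dist ys, symmetric] es
    by (rule refl)
  then show "{h, k} = {hd ys, last ys}" unfolding pn by blast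
qed

lemma acyclic_rest: "\<not> has_cycle (delete_verts G {u, v})"
proof
  assume "has_cycle (delete_verts G {u, v})"
  then obtain C where C: "is_cycle C" "subgraph_of C (delete_verts G {u, v})"
    unfolding has_cycle_def by blast
  then have "C = cycle_of (u # ys)" using uniq subgraph_trans[OF C(2) subgraph_delete_verts] by simp
  then show False using C(2) by (auto simp: subgraph_of_def delete_verts_def)
qed

lemma inv: "inverse_on (delete_verts G {u, v}) B"
  and link: "B x y \<noteq> 0 \<Longrightarrow> linked (delete_verts G {u, v}) x y"
  and diag: "B x x = 0"
  and sign: "B x y \<in> {-1, 0, 1}"
  and entry: "alt_path (delete_verts G {u, v}) m x p y \<Longrightarrow> B x y = alt_sign p"
  and exists_alt: "B x y \<noteq> 0 \<Longrightarrow> \<exists>p. alt_path (delete_verts G {u, v}) m x p y"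
  using alt alt_inverse_linked[OF alt] alt_inverse_diag[OF alt] alt_inverse_sign[OF alt]
  by (auto simp: alt_inverse_def)

lemma sym: "B x y = B y x"
  using inv unfolding inverse_on_def by blast

text \<open>The mate of \<open>u\<close> is the leaf \<open>v\<close>, which no cycle contains. So
  one peg is always present in this step.\<close>

lemma hub_exposed: "u \<in> exposed m (set (u # ys))"
  using leaf_not_in mated_leaf_pair[OF mated leaf] by (simp add: exposed_def)

text \<open>The diagonal entry is \<open>- adj G u u\<close>, and here the weight 2 of a loop
  matters. Correspondingly, a loop has only one attachment and is never good.\<close>

lemma loop_step:
  assumes "ys = []"
  shows "leaf_extension G u v B v v = -2" "\<not> sign_good m (set (u # ys))"
proof -
  have "(\<Sum>k\<in>verts G - {u, v}. real (adj G u k) * B h k) = 0" if h: "{u, h} \<in> edges G" for h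
  proof (rule ccontr)
    assume "(\<Sum>k\<in>verts G - {u, v}. real (adj G u k) * B h k) \<noteq> 0"
    then obtain k where k: "{u, k} \<in> edges G" "B h k \<noteq> 0"
      using neighbour_sum_nonzero[OF graph leaf inv link, of "B h"] by blast
    then have "h = k" using link[of h k] neighbours_linked(1)[OF h] assms by blast
    then show False using k diag by simp
  qed
  then have "(\<Sum>h\<in>verts G - {u, v}. real (adj G u h) *
        (\<Sum>k\<in>verts G - {u, v}. real (adj G u k) * B h k)) = 0"
    by (intro sum.neutral) (simp add: adj_def)
  moreover have "adj G u u = 2" using sub assms by (auto simp: subgraph_of_def adj_def)
  ultimately show "leaf_extension G u v B v v = -2" by (simp add: leaf_ext_unfold(8)[OF graph leaf inv])
  have "exposed m (set (u # ys)) = {u}" using hub_exposed assms by (auto simp: exposed_def)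
  then show "\<not> sign_good m (set (u # ys))" by (simp add: sign_good_def)
qed

context
  assumes ne: "ys \<noteq> []"
begin

lemma ends:
  "hd ys \<noteq> last ys" "hd ys \<in> verts G - {u, v}" "last ys \<in> verts G - {u, v}"
  "{u, hd ys} \<in> edges G" "{u, last ys} \<in> edges G"
  "path_between (delete_verts G {u, v}) (hd ys) ys (last ys)"
proof -
  show "hd ys \<noteq> last ys" using dist len ne by (cases ys) auto
  have "{u, x} \<in> edges G" if "x = hd ys \<or> x = last ys" for x
    using that sub cycle_neighbours[OF dist ne, of x] unfolding subgraph_of_def by blast
  then show "{u, hd ys} \<in> edges G" "{u, last ys} \<in> edges G" by auto
  have "set ys \<subseteq> verts G" "path_edges ys \<subseteq> edges G"
    using sub ne by (auto simp: subgraph_of_def path_edges_Cons)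
  then have "path_between G (hd ys) ys (last ys)" using ne dist by (simp add: path_between_def)
  then show "path_between (delete_verts G {u, v}) (hd ys) ys (last ys)"
    using path_between_delete dist leaf_not_in by fastforce
  from path_between_verts[OF this]
  show "hd ys \<in> verts G - {u, v}" "last ys \<in> verts G - {u, v}" by (auto simp: delete_verts_def)
qed

lemma no_loop: "adj G u u = 0"
proof -
  have "{u} \<notin> edges G"
  proof
    assume "{u} \<in> edges G"
    then have "cycle_of [u] = cycle_of (u # ys)"
      using uniq loop_is_cycle[of u G] leaf by (simp add: leaf_pair_def)
    then have "set [u] = set (u # ys)" by (metis cycle_of_sel(1))
    then show False using ne dist by (cases ys) auto
  qed
  then show ?thesis by (simp add: adj_def)
qed

text \<open>The two cycle neighbours are the only neighbours of \<open>u\<close> that share a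
  component after the deletion. So either \<open>y\<close> lies in that component and both terms
  appear, or at most one neighbour contributes.\<close>

lemma neighbour_sum:
  shows "(\<Sum>h\<in>verts G - {u, v}. real (adj G u h) * B h y) \<in> {-1, 0, 1} \<or>
     (\<Sum>h\<in>verts G - {u, v}. real (adj G u h) * B h y) = B (hd ys) y + B (last ys) y"
    (is "?S \<in> _ \<or> _")
  and "linked (delete_verts G {u, v}) (hd ys) y \<Longrightarrow>
     (\<Sum>h\<in>verts G - {u, v}. real (adj G u h) * B h y) = B (hd ys) y + B (last ys) y"
proof -
  let ?H = "delete_verts G {u, v}"
  have fin: "finite (verts G - {u, v})" using graph by (simp add: is_graph_def)
  have ab: "linked ?H (hd ys) (last ys)" using ends(6) unfolding linked_def by blast
  have a1: "adj G u (hd ys) = 1" "adj G u (last ys) = 1"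
    using ends by (auto simp: adj_def)
  show *: "?S = B (hd ys) y + B (last ys) y" if l: "linked ?H (hd ys) y"
  proof -
    have "real (adj G u h) * B h y = 0" if h: "h \<noteq> hd ys" "h \<noteq> last ys" for h
    proof (rule ccontr)
      assume "real (adj G u h) * B h y \<noteq> 0"
      then have "{u, h} \<in> edges G" "B h y \<noteq> 0" by (auto simp: adj_def split: if_splits)
      then have "linked ?H h (hd ys)" using link linked_sym[OF l] linked_trans by metis
      then show False using neighbours_linked(2)[OF \<open>{u, h} \<in> edges G\<close> ends(4)] h by blast
    qed
    then have "?S = real (adj G u (hd ys)) * B (hd ys) y + real (adj G u (last ys)) * B (last ys) y"
      using ends by (intro sum_eq_pair fin) auto
    then show ?thesis using a1 by simp
  qed
  show "?S \<in> {-1, 0, 1} \<or> ?S = B (hd ys) y + B (last ys) y"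
  proof (cases "?S = 0 \<or> linked ?H (hd ys) y")
    case True
    then show ?thesis using * by auto
  next
    case False
    then obtain k where k: "k \<in> verts G - {u, v}" "{u, k} \<in> edges G" "B k y \<noteq> 0"
      using neighbour_sum_nonzero[OF graph leaf inv link, of "\<lambda>h. B h y"] by blast
    have nl: "\<not> linked ?H (last ys) y" using False linked_trans[OF ab] by blast
    have "?S = B k y"
    proof (rule neighbour_sum_single[OF graph leaf inv link k(1,2)])
      fix h assume h: "h \<in> verts G - {u, v}" "{u, h} \<in> edges G" "B h y \<noteq> 0"
      then have "linked ?H h k"
        using link[OF h(3)] link[OF k(3)] linked_sym linked_trans by metis
      then have "h = k \<or> h = hd ys \<or> h = last ys" using neighbours_linked(2)[OF h(2) k(2)] by blast
      then show "h = k" using link[OF h(3)] False nl by auto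
    qed
    then show ?thesis using sign[of k y] by simp
  qed
qed

text \<open>No other two distinct neighbours of \<open>u\<close> are linked and the diagonal of
  \<open>B\<close> is zero, so the quadratic form reduces to \<open>B (hd ys) (last ys)\<close> and
  its transpose.\<close>

lemma leaf_diag: "leaf_extension G u v B v v = 2 * B (hd ys) (last ys)"
proof -
  let ?H = "delete_verts G {u, v}"
  let ?S = "\<lambda>h. \<Sum>k\<in>verts G - {u, v}. real (adj G u k) * B h k"
  have fin: "finite (verts G - {u, v})" using graph by (simp add: is_graph_def)
  have a1: "adj G u (hd ys) = 1" "adj G u (last ys) = 1"
    using ends by (auto simp: adj_def)
  have ab: "linked ?H (hd ys) (last ys)" "linked ?H (hd ys) (hd ys)"
    using ends(2,6) linked_refl[of "hd ys" ?H] by (auto simp: linked_def delete_verts_def)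
  have S: "?S h = (\<Sum>k\<in>verts G - {u, v}. real (adj G u k) * B k h)" for h
    using sym by (intro sum.cong) auto
  have "real (adj G u h) * ?S h = 0" if h: "h \<noteq> hd ys" "h \<noteq> last ys" for h
  proof (rule ccontr)
    assume "real (adj G u h) * ?S h \<noteq> 0"
    then have e: "{u, h} \<in> edges G" and "?S h \<noteq> 0" by (auto simp: adj_def split: if_splits)
    then obtain k where k: "{u, k} \<in> edges G" "B h k \<noteq> 0"
      using neighbour_sum_nonzero[OF graph leaf inv link, of "B h"] by blast
    then have "h = k" using neighbours_linked(2)[OF e k(1) link[OF k(2)]] h by blast
    then show False using k diag by simp
  qed
  then have "(\<Sum>h\<in>verts G - {u, v}. real (adj G u h) * ?S h)
     = real (adj G u (hd ys)) * ?S (hd ys) + real (adj G u (last ys)) * ?S (last ys)"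
    using ends by (intro sum_eq_pair fin) auto
  also have "\<dots> = 2 * B (hd ys) (last ys)"
    using a1 neighbour_sum(2)[OF ab(1)] neighbour_sum(2)[OF ab(2)] S diag sym[of "last ys" "hd ys"]
    by simp
  finally show ?thesis by (simp add: leaf_ext_unfold(8)[OF graph leaf inv] no_loop)
qed

lemma mate_in_rest: "z \<in> set ys \<Longrightarrow> m z \<in> verts G - {u, v} \<and> m (m z) = z"
  using mated_leaf_pair[OF mated leaf] ends(6)
  by (auto simp: path_between_def mated_def delete_verts_def)

lemma hub_only_exposed:
  "exposed m (set (u # ys)) = {u} \<longleftrightarrow> (\<forall>z\<in>set ys. m z \<in> set ys)"
proof -
  have e: "z \<in> exposed m (set (u # ys)) \<longleftrightarrow> m z \<notin> set ys" if "z \<in> set ys" for z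
    using mate_in_rest[OF that] that by (auto simp: exposed_def)
  have "exposed m (set (u # ys)) \<subseteq> insert u (set ys)" by (auto simp: exposed_def)
  then have "exposed m (set (u # ys)) = {u} \<longleftrightarrow> (\<forall>z\<in>set ys. z \<notin> exposed m (set (u # ys)))"
    using hub_exposed dist by auto
  then show ?thesis using e by simp
qed

text \<open>\<open>ys\<close> is the only path between its ends in the remainder, so the entry is
  nonzero iff \<open>ys\<close> alternates, that is, iff all its vertices have their mates on
  it.\<close>

lemma ends_entry: "B (hd ys) (last ys) \<noteq> 0 \<longleftrightarrow> exposed m (set (u # ys)) = {u}"
proof
  assume "B (hd ys) (last ys) \<noteq> 0"
  then obtain p where p: "path_between (delete_verts G {u, v}) (hd ys) p (last ys)" "alternating m p"
    using exists_alt unfolding alt_path_def by blast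
  then have "alternating m ys" using acyclic_path_unique[OF acyclic_rest ends(6)] by blast
  then show "exposed m (set (u # ys)) = {u}"
    using hub_only_exposed alternating_mate mate_in_rest by metis
next
  assume "exposed m (set (u # ys)) = {u}"
  then have "alternating m ys"
    using mated_path_alternating[OF acyclic_rest mated_leaf_pair(3)[OF mated leaf] ends(6)]
      hub_only_exposed by blast
  then have "B (hd ys) (last ys) = alt_sign ys" using entry ends(6) by (simp add: alt_path_def)
  then show "B (hd ys) (last ys) \<noteq> 0" using alt_sign_cases[of ys] by auto
qed

lemma exposed_pair:
  assumes ys: "ys = as @ y # bs" and as: "alternating m (rev as)" and bs: "alternating m bs"
    and y: "m y \<notin> set ys"
  shows "exposed m (set (u # ys)) = {u, y}"
proof -
  have m1: "m z \<in> set (rev as)" if "z \<in> set (rev as)" for z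
    by (rule alternating_mate[OF as _ that]) (use mate_in_rest ys in auto)
  have m2: "m z \<in> set bs" if "z \<in> set bs" for z
    by (rule alternating_mate[OF bs _ that]) (use mate_in_rest ys in auto)
  have "m y \<noteq> u" using mate_in_rest[of y] ys by auto
  moreover have "y \<in> set ys" using ys by simp
  ultimately have "y \<in> exposed m (set (u # ys))" using y by (simp add: exposed_def)
  moreover have "z = u \<or> z = y" if z: "z \<in> exposed m (set (u # ys))" for z
  proof (rule ccontr)
    assume "\<not> ?thesis"
    then have "z \<in> set as \<or> z \<in> set bs" using z unfolding exposed_def ys by simp
    then have "m z \<in> set ys" using m1[of z] m2[of z] unfolding ys by auto
    then show False using z by (simp add: exposed_def)
  qed
  ultimately show ?thesis using hub_exposed by blast
qed

text \<open>Both alternating paths from \<open>x\<close> enter \<open>ys\<close> at the same vertex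
  \<open>y\<close> and part there. Then \<open>y\<close> is matched backwards to a vertex off the
  cycle and both branches alternate, so nothing but \<open>u\<close> and \<open>y\<close> is
  exposed.\<close>

lemma common_row:
  assumes "B x (hd ys) \<noteq> 0" "B x (last ys) \<noteq> 0"
  shows "\<exists>y. y \<noteq> u \<and> exposed m (set (u # ys)) = {u, y} \<and>
    (4 dvd card (set (u # ys)) \<longrightarrow> B x (hd ys) + B x (last ys) = 0)"
proof -
  let ?H = "delete_verts G {u, v}"
  obtain p q where p: "path_between ?H x p (hd ys)" "alternating m p"
    and q: "path_between ?H x q (last ys)" "alternating m q"
    and val: "B x (hd ys) = alt_sign p" "B x (last ys) = alt_sign q"
    using exists_alt[OF assms(1)] exists_alt[OF assms(2)] entry unfolding alt_path_def by blast
  obtain c as y bs where s: "ys = as @ y # bs" "p = c @ y # rev as" "q = c @ y # bs"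
    "set c \<inter> set ys = {}"
    by (rule path_to_both_ends[OF acyclic_rest ends(6) p(1) q(1)])
  \<comment> \<open>With \<open>c\<close> of even length, the mate of \<open>y\<close> would be the
    next vertex on both branches at once.\<close>
  have "odd (length c)"
  proof
    assume "even (length c)"
    then have "alternating m (y # rev as)" "alternating m (y # bs)"
      using alternating_append_even[of m c] p(2) q(2) s(2,3) by blast+
    moreover from this have "rev as \<noteq> []" "bs \<noteq> []" by auto
    ultimately have "m y \<in> set (rev as)" "m y \<in> set bs"
      by (metis alternating.simps(3) list.exhaust list.set_intros(1))+
    then have "m y \<in> set as" "m y \<in> set bs" by simp_all
    then show False using dist s(1) by auto
  qed
  then obtain c' w where c: "c = c' @ [w]" "even (length c')" by (cases c rule: rev_cases) auto
  then have "alternating m (w # y # rev as)" "alternating m (w # y # bs)"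
    using alternating_append_even[of m c' "w # y # rev as"]
      alternating_append_even[of m c' "w # y # bs"] p(2) q(2) s(2,3) by simp_all
  then have alts: "y = m w" "alternating m (rev as)" "alternating m bs" by auto
  have "w \<in> verts G" using p(1) s c by (auto simp: path_between_def delete_verts_def)
  then have "m y = w" using alts mated by (simp add: mated_def)
  then have "m y \<notin> set ys" using s c by auto
  moreover have "y \<noteq> u" using dist s(1) by auto
  \<comment> \<open>The cycle consists of \<open>u\<close>, \<open>y\<close> and branches of 2j and
    2k vertices; the paths have i + j + 1 and i + k + 1 pairs. So 4 divides the cycle length iff j +
    k is odd, iff the signs differ.\<close>
  moreover have "alt_sign p + alt_sign q = 0" if d: "4 dvd card (set (u # ys))"
  proof -
    obtain i j k where ijk: "length c' = 2 * i" "length as = 2 * j" "length bs = 2 * k"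
      using c(2) alternating_even_length[OF alts(2)] alternating_even_length[OF alts(3)]
      by (auto elim!: evenE)
    have "card (set (u # ys)) = length (u # ys)" using dist by (rule distinct_card)
    then have "4 dvd 2 + 2 * j + 2 * k" using d s(1) ijk by (simp add: add_ac)
    then have "odd (j + k)" by presburger
    moreover have "length p div 2 = i + j + 1" "length q div 2 = i + k + 1"
      using s c ijk by auto
    ultimately show ?thesis unfolding alt_sign_def by (cases "even j"; cases "even k") (simp_all add: power_add)
  qed
  ultimately show ?thesis using exposed_pair[OF s(1) alts(2,3)] val by metis
qed

text \<open>The row is that of the mate of \<open>y\<close>: stepping to \<open>y\<close> and on
  along either side gives alternating paths to both ends, with equal signs by the length modulo
  4.\<close>

lemma common_row_exists:
  assumes "exposed m (set (u # ys)) = {u, y}" "y \<noteq> u" "\<not> 4 dvd card (set (u # ys))"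
  shows "\<exists>x. x \<noteq> u \<and> x \<noteq> v \<and> \<bar>B x (hd ys) + B x (last ys)\<bar> = 2"
proof -
  let ?H = "delete_verts G {u, v}"
  have "y \<in> exposed m (set (u # ys))" using assms(1) by blast
  then have y: "y \<in> set ys" "m y \<notin> set ys" using assms(2) by (auto simp: exposed_def)
  then obtain as bs where s: "ys = as @ y # bs" by (meson split_list)
  have "m z \<in> set ys" if "z \<in> set ys" "z \<noteq> y" for z
  proof -
    have "z \<notin> exposed m (set (u # ys))" using assms(1) that dist by auto
    then have "m z \<in> set (u # ys)" using that by (auto simp: exposed_def)
    then show ?thesis using mate_in_rest[OF that(1)] by auto
  qed
  then have "\<forall>z\<in>set as \<union> set bs. m z \<in> set (as @ y # bs)" using s dist by auto
  then have alts: "alternating m (rev as)" "alternating m bs"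
    using mated_path_split[OF acyclic_rest mated_leaf_pair(3)[OF mated leaf], of "hd ys" as y bs "last ys"]
      ends(6) s y(2) by auto
  define w where "w = m y"
  have w: "w \<in> verts G - {u, v}" "m w = y" "w \<notin> set ys"
    using mate_in_rest[OF y(1)] y(2) by (auto simp: w_def)
  have wy: "{w, y} \<in> edges ?H" "w \<in> verts ?H"
    using mated_leaf_pair(3)[OF mated leaf] w unfolding mated_def
    by (auto simp: delete_verts_def)
  have sub: "path_between ?H y (y # bs) (last ys)"
    using path_between_suffix[of ?H "hd ys" as "y # bs" "last ys"] ends(6) s by simp
  have "path_between ?H (hd ys) (as @ [y]) y"
    using path_between_prefix[of ?H "hd ys" "as @ [y]" bs "last ys"] ends(6) s by simp
  from path_between_rev[OF this] have sua: "path_between ?H y (y # rev as) (hd ys)" by simp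
  have "alt_path ?H m w (w # y # rev as) (hd ys)" "alt_path ?H m w (w # y # bs) (last ys)"
    unfolding alt_path_def using path_between_Cons[OF sua wy(2,1)] path_between_Cons[OF sub wy(2,1)]
      w s alts by auto
  then have val: "B w (hd ys) = alt_sign (w # y # rev as)" "B w (last ys) = alt_sign (w # y # bs)"
    using entry by auto
  obtain j k where jk: "length as = 2 * j" "length bs = 2 * k"
    using alternating_even_length[OF alts(1)] alternating_even_length[OF alts(2)]
    by (auto elim!: evenE)
  have "card (set (u # ys)) = length (u # ys)" using dist by (rule distinct_card)
  then have "\<not> 4 dvd 2 + 2 * j + 2 * k" using assms(3) s jk by (simp add: add_ac)
  then have "even (j + k)" by presburger
  then have "\<bar>B w (hd ys) + B w (last ys)\<bar> = 2"
    unfolding val alt_sign_def using jk by (cases "even j"; cases "even k") auto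
  then show ?thesis using w by blast
qed

text \<open>Two nonzero terms in a neighbour sum occur only if there is exactly one further
  attachment, and then goodness provides the divisibility by 4 that cancels them. The diagonal entry
  vanishes because \<open>u\<close> is not the only attachment.\<close>

lemma cycle_step_good:
  assumes "sign_good m (set (u # ys))"
  shows "leaf_extension G u v B x y \<in> {-1, 0, 1}" "leaf_extension G u v B x x = 0"
proof -
  note uf = leaf_ext_unfold[OF graph leaf inv]
  have uv: "u \<noteq> v" using leaf by (simp add: leaf_pair_def)
  have "exposed m (set (u # ys)) \<noteq> {u}" using assms by (auto simp: sign_good_def)
  then have vv: "leaf_extension G u v B v v = 0" using leaf_diag ends_entry by auto
  have S: "(\<Sum>h\<in>verts G - {u, v}. real (adj G u h) * B h y) \<in> {-1, 0, 1}" for y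
  proof -
    have "B (hd ys) y + B (last ys) y \<in> {-1, 0, 1}"
    proof (cases "B (hd ys) y = 0 \<or> B (last ys) y = 0")
      case True
      then show ?thesis using sign[of "hd ys" y] sign[of "last ys" y] by auto
    next
      case False
      then obtain z where "z \<noteq> u" "exposed m (set (u # ys)) = {u, z}"
        "4 dvd card (set (u # ys)) \<longrightarrow> B y (hd ys) + B y (last ys) = 0"
        using common_row[of y] sym[of y "hd ys"] sym[of y "last ys"] by auto
      then have "B y (hd ys) + B y (last ys) = 0" using assms by (auto simp: sign_good_def)
      then show ?thesis using sym[of y "hd ys"] sym[of y "last ys"] by simp
    qed
    then show ?thesis using neighbour_sum(1)[of y] by auto
  qed
  show "leaf_extension G u v B x x = 0"
  proof -
    consider "x = u" | "x = v" | "x \<noteq> u" "x \<noteq> v" by blast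
    then show ?thesis using uf(3)[of u] uf(7)[of x x] vv diag uv by cases auto
  qed
  consider "x = u" "y = v" | "x = u" "y \<noteq> v" | "y = u" "x = v" | "y = u" "x \<noteq> v" | "x = v" "y = v"
    | "x = v" "y \<noteq> u" "y \<noteq> v" | "y = v" "x \<noteq> u" "x \<noteq> v" | "x \<noteq> u" "x \<noteq> v" "y \<noteq> u" "y \<noteq> v" by blast
  then show "leaf_extension G u v B x y \<in> {-1, 0, 1}"
  proof cases
    case 1 then show ?thesis using uf(1) by simp
  next
    case 2 then show ?thesis using uf(3) by simp
  next
    case 3 then show ?thesis using uf(2) by simp
  next
    case 4 then show ?thesis using uf(4) by simp
  next
    case 5 then show ?thesis using vv by simp
  next
    case 6 then show ?thesis using uf(5)[of y] S[of y] by auto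
  next
    case 7 then show ?thesis using uf(6)[of x] S[of x] by auto
  next
    case 8 then show ?thesis using uf(7)[of x y] sign[of x y] by simp
  qed
qed

text \<open>If \<open>u\<close> is the only attachment, the diagonal entry of the leaf is 2 or -2.
  Otherwise there are exactly two attachments on a cycle of the wrong length, and another entry of
  the leaf row is 2 or -2.\<close>

lemma cycle_step_bad:
  assumes "\<not> sign_good m (set (u # ys))"
  shows "\<exists>x y. leaf_extension G u v B x y \<notin> {-1, 0, 1}"
proof (cases "exposed m (set (u # ys)) = {u}")
  case True
  then have "B (hd ys) (last ys) = 1 \<or> B (hd ys) (last ys) = -1"
    using ends_entry sign[of "hd ys" "last ys"] by auto
  then have "leaf_extension G u v B v v \<notin> {-1, 0, 1}" unfolding leaf_diag by auto
  then show ?thesis by blast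
next
  case False
  have fin: "finite (exposed m (set (u # ys)))" by (auto simp: exposed_def)
  obtain y where y: "y \<in> exposed m (set (u # ys))" "y \<noteq> u" using False hub_exposed by blast
  then have "card {u, y} \<le> card (exposed m (set (u # ys)))"
    using hub_exposed fin by (intro card_mono) auto
  then have "card (exposed m (set (u # ys))) = 2" "\<not> 4 dvd card (set (u # ys))"
    using assms y(2) by (auto simp: sign_good_def)
  moreover from this have "exposed m (set (u # ys)) = {u, y}"
    using card_subset_eq[OF fin, of "{u, y}"] hub_exposed y by auto
  ultimately obtain x where x: "x \<noteq> u" "x \<noteq> v" "\<bar>B x (hd ys) + B x (last ys)\<bar> = 2"
    using common_row_exists y(2) by blast
  then have "B x (hd ys) \<noteq> 0"
    using sign[of x "last ys"] by auto
  then have "linked (delete_verts G {u, v}) (hd ys) x" using link linked_sym by metis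
  then have "leaf_extension G u v B v x = - (B x (hd ys) + B x (last ys))"
    using neighbour_sum(2)[of x] leaf_ext_unfold(5)[OF graph leaf inv x(1,2)]
      sym[of x "hd ys"] sym[of x "last ys"] by simp
  then have "leaf_extension G u v B v x \<notin> {-1, 0, 1}" using x(3) by auto
  then show ?thesis by blast
qed

end

end

text \<open>Support and diagonal belong to the claim because \<open>sign_leaf_extension\<close>
  needs them in the steps that do not meet the cycle.\<close>

lemma unicyclic_inverse:
  assumes "K2_reducible G" "is_graph G" "mated G m" "is_cycle Q" "subgraph_of Q G"
    and "\<And>C. is_cycle C \<Longrightarrow> subgraph_of C G \<Longrightarrow> C = Q"
  shows "\<exists>B. inverse_on G B \<and> (\<forall>x y. B x y \<noteq> 0 \<longrightarrow> linked G x y) \<and>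
    (if sign_good m (verts Q) then (\<forall>x y. B x y \<in> {-1, 0, 1}) \<and> (\<forall>x. B x x = 0)
     else (\<exists>x y. B x y \<notin> {-1, 0, 1}))"
  using assms
proof (induction rule: K2_reducible_induct)
  case empty
  then show ?case by (auto simp: is_cycle_iff subgraph_of_def empty_graph_def)
next
  case (step G u v)
  let ?H = "delete_verts G {u, v}"
  note graph = step.hyps(1) and leaf = step.hyps(2)
  have mH: "mated ?H m" using mated_leaf_pair(3)[OF step.prems(1) leaf] .
  have vQ: "v \<notin> verts Q" using leaf_not_in_cycle[OF leaf step.prems(2,3)] .
  have uV: "u \<in> verts G" using leaf by (simp add: leaf_pair_def)
  show ?case
  proof (cases "u \<in> verts Q")
    case True
    obtain ys where ys: "distinct (u # ys)" "length (u # ys) \<noteq> 2" "Q = cycle_of (u # ys)"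
      by (rule cycle_through_vertex[OF step.prems(2) True])
    have "\<not> has_cycle ?H"
    proof
      assume "has_cycle ?H"
      then obtain C where C: "is_cycle C" "subgraph_of C ?H" unfolding has_cycle_def by blast
      have "C = Q" using step.prems(4)[OF C(1) subgraph_trans[OF C(2) subgraph_delete_verts]] .
      then show False using C(2) True by (auto simp: subgraph_of_def delete_verts_def)
    qed
    \<comment> \<open>The reduced graph has no cycle, so the induction hypothesis does not apply;
      the forest inverse takes its place.\<close>
    then obtain B where alt: "alt_inverse ?H m B"
      using forest_alt_inverse[OF step.hyps(4,3) _ mH] by blast
    have inv: "inverse_on ?H B" using alt by (simp add: alt_inverse_def)
    have uniq: "\<And>C. is_cycle C \<Longrightarrow> subgraph_of C G \<Longrightarrow> C = cycle_of (u # ys)"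
      using step.prems(4) ys(3) by simp
    have sub: "subgraph_of (cycle_of (u # ys)) G" using step.prems(3) ys(3) by simp
    note ctx = graph leaf step.prems(1) ys(1,2) sub uniq alt
    have "verts Q = set (u # ys)" using ys(3) by simp
    moreover have "if sign_good m (set (u # ys))
        then (\<forall>x y. leaf_extension G u v B x y \<in> {-1, 0, 1}) \<and> (\<forall>x. leaf_extension G u v B x x = 0)
        else (\<exists>x y. leaf_extension G u v B x y \<notin> {-1, 0, 1})"
    proof (cases "ys = []")
      case True
      have "leaf_extension G u v B v v \<notin> {-1, 0, 1}" using loop_step(1)[OF ctx True] by simp
      then show ?thesis using loop_step(2)[OF ctx True] by auto
    next
      case False
      then show ?thesis using cycle_step_good[OF ctx False] cycle_step_bad[OF ctx False] by auto
    qed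
    moreover have "\<forall>x y. leaf_extension G u v B x y \<noteq> 0 \<longrightarrow> linked G x y"
      using linked_leaf_extension[OF graph leaf inv alt_inverse_linked[OF alt]] by blast
    ultimately show ?thesis using inverse_on_leaf_extension[OF graph leaf inv]
      by (intro exI[of _ "leaf_extension G u v B"]) simp
  next
    case False
    have QH: "subgraph_of Q ?H" "\<And>C. is_cycle C \<Longrightarrow> subgraph_of C ?H \<Longrightarrow> C = Q"
    proof -
      have "e \<inter> {u, v} = {}" if "e \<in> edges Q" for e
      proof -
        obtain xs where "Q = cycle_of xs" "xs \<noteq> []" using step.prems(2) is_cycle_iff by blast
        then have "e \<subseteq> verts Q" using that path_edges_subset_set[of e xs] by auto
        then show ?thesis using False vQ by auto
      qed
      then show "subgraph_of Q ?H"
        using step.prems(3) False vQ by (auto simp: subgraph_of_def delete_verts_def)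
      show "C = Q" if "is_cycle C" "subgraph_of C ?H" for C
        using step.prems(4)[OF that(1) subgraph_trans[OF that(2) subgraph_delete_verts]] .
    qed
    obtain B where B: "inverse_on ?H B" "\<And>x y. B x y \<noteq> 0 \<Longrightarrow> linked ?H x y"
      "if sign_good m (verts Q) then (\<forall>x y. B x y \<in> {-1, 0, 1}) \<and> (\<forall>x. B x x = 0)
       else (\<exists>x y. B x y \<notin> {-1, 0, 1})"
      using step.IH[OF mH step.prems(2) QH] by blast
    \<comment> \<open>Any failure yields a cycle through \<open>u\<close>, but the only cycle avoids
      \<open>u\<close>.\<close>
    have "separated G u v"
      unfolding separated_def
    proof (intro conjI allI impI notI)
      assume "{u} \<in> edges G"
      then have "cycle_of [u] = Q" by (intro step.prems(4) loop_is_cycle[OF _ uV])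
      then show False using False by auto
    next
      fix h k assume e: "{u, h} \<in> edges G" "{u, k} \<in> edges G" and l: "linked ?H h k"
      show "h = k"
      proof (rule ccontr)
        assume "h \<noteq> k"
        obtain p where p: "path_between ?H h p k" using l unfolding linked_def by blast
        then have "u \<notin> set p" by (auto simp: path_between_def delete_verts_def)
        then have "cycle_of (u # p) = Q"
          using \<open>h \<noteq> k\<close> by (intro step.prems(4)
            path_closes_to_cycle[OF path_between_mono[OF p subgraph_delete_verts] e uV])
        then show False using False by auto
      qed
    qed
    note sl = sign_leaf_extension[OF graph leaf B(1,2) this]
    have "if sign_good m (verts Q)
        then (\<forall>x y. leaf_extension G u v B x y \<in> {-1, 0, 1}) \<and> (\<forall>x. leaf_extension G u v B x x = 0)
        else (\<exists>x y. leaf_extension G u v B x y \<notin> {-1, 0, 1})"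
    proof (cases "sign_good m (verts Q)")
      case True
      then show ?thesis using B(3) sl by auto
    next
      case False
      then obtain x y where xy: "B x y \<notin> {-1, 0, 1}" using B(3) by auto
      \<comment> \<open>Since 0 is admissible, the entry is nonzero; so both indices lie in the
        reduced graph, where the extension agrees with \<open>B\<close>.\<close>
      then have "linked ?H x y" using B(2)[of x y] by auto
      then have "x \<in> verts ?H" "y \<in> verts ?H" unfolding linked_def using path_between_verts by metis+
      then have "leaf_extension G u v B x y = B x y"
        using leaf_ext_unfold(7)[OF graph leaf B(1)] by (simp add: delete_verts_def)
      then have "leaf_extension G u v B x y \<notin> {-1, 0, 1}" using xy by simp
      then show ?thesis unfolding if_not_P[OF False] by (intro exI[of _ x] exI[of _ y])
    qed
    moreover have "\<forall>x y. leaf_extension G u v B x y \<noteq> 0 \<longrightarrow> linked G x y"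
      using linked_leaf_extension[OF graph leaf B(1,2)] by blast
    ultimately show ?thesis using inverse_on_leaf_extension[OF graph leaf B(1)] by blast
  qed
qed

text \<open>Every cycle must use \<open>f\<close>. Without \<open>f\<close> it is a path between the
  ends of \<open>f\<close> in a forest, which is unique up to direction, and \<open>cycle_of\<close>
  does not see the direction.\<close>

lemma unique_cycle:
  assumes acyc: "\<not> has_cycle (delete_edges G {f})"
    and C: "is_cycle C" "subgraph_of C G" and Q: "is_cycle Q" "subgraph_of Q G"
  shows "C = Q"
proof -
  let ?T = "delete_edges G {f}"
  have ex: "\<exists>xs. xs \<noteq> [] \<and> D = cycle_of xs \<and> f = {last xs, hd xs} \<and> path_between ?T (hd xs) xs (last xs)"
    if D: "is_cycle D" "subgraph_of D G" for D
  proof -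
    have "f \<in> edges D"
    proof (rule ccontr)
      assume "f \<notin> edges D"
      then have "subgraph_of D ?T" using D(2) by (auto simp: subgraph_of_def delete_edges_def)
      then show False using acyc D(1) unfolding has_cycle_def by blast
    qed
    then obtain xs where xs: "distinct xs" "xs \<noteq> []" "D = cycle_of xs"
      "f = {last xs, hd xs}" "f \<notin> path_edges xs"
      by (rule cycle_through_edge[OF D(1)])
    then have "path_between ?T (hd xs) xs (last xs)"
      using D(2) by (auto simp: path_between_def subgraph_of_def delete_edges_def)
    then show ?thesis using xs by (intro exI[of _ xs] conjI)
  qed
  obtain xs where xs: "C = cycle_of xs" "f = {last xs, hd xs}" "path_between ?T (hd xs) xs (last xs)"
    using ex[OF C] by (elim exE conjE)
  obtain ys where ys: "Q = cycle_of ys" "f = {last ys, hd ys}" "path_between ?T (hd ys) ys (last ys)"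
    using ex[OF Q] by (elim exE conjE)
  from xs(2) ys(2) consider "hd xs = hd ys" "last xs = last ys" | "hd xs = last ys" "last xs = hd ys"
    by (auto simp: doubleton_eq_iff)
  then show ?thesis
  proof cases
    case 1
    then show ?thesis using acyclic_path_unique[OF acyc xs(3)] xs(1) ys(1,3) by simp
  next
    case 2
    then have "xs = rev ys" using acyclic_path_unique[OF acyc xs(3)] path_between_rev[OF ys(3)] by simp
    then show ?thesis using xs(1) ys(1) by (simp add: cycle_of_rev)
  qed
qed

lemma unicyclic_acyclic_edge:
  assumes "unicyclic G"
  obtains f where "\<not> has_cycle (delete_edges G {f})"
proof -
  let ?P = "\<lambda>k. \<exists>F. F \<subseteq> edges G \<and> card F = k \<and> \<not> has_cycle (delete_edges G F)"
  \<comment> \<open>\<open>LeastI\<close> needs some admissible set of edges; every cycle has an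
    edge, so deleting all edges works.\<close>
  have "\<not> has_cycle (delete_edges G (edges G))"
    by (auto simp: has_cycle_def is_cycle_iff subgraph_of_def delete_edges_def)
  then have "?P (card (edges G))" by blast
  then have "?P (LEAST k. ?P k)" by (rule LeastI)
  then have "?P 1" using assms by (simp add: unicyclic_def cycle_rank_def)
  then obtain F where "card F = 1" "\<not> has_cycle (delete_edges G F)" by blast
  then show ?thesis using that by (metis card_1_singletonE)
qed

section \<open>Graphs that are not \<open>K\<^sub>2\<close>-reducible\<close>

text \<open>Take an end of a longest path: a neighbour off the path would extend it, and one beyond
  the second vertex would give two paths with the same ends.\<close>

lemma acyclic_low_degree:
  assumes "is_graph G" "\<not> has_cycle G" "verts G \<noteq> {}"
  shows "\<exists>x\<in>verts G. card {e \<in> edges G. x \<in> e} \<le> 1"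
proof -
  have fin: "finite (verts G)" using assms(1) by (simp add: is_graph_def)
  define P where "P n \<longleftrightarrow> (\<exists>x p y. path_between G x p y \<and> length p = n)" for n
  obtain a where "a \<in> verts G" using assms(3) by blast
  then have "path_between G a [a] a" by (simp add: path_between_def)
  then have P1: "P 1" unfolding P_def by (intro exI conjI) auto
  have bound: "n \<le> card (verts G)" if "P n" for n
  proof -
    obtain x p y where "path_between G x p y" "length p = n" using \<open>P n\<close> unfolding P_def by blast
    then show ?thesis using card_mono[OF fin, of "set p"] by (auto simp: path_between_def distinct_card)
  qed
  obtain n where n: "P n" "\<And>k. P k \<Longrightarrow> k \<le> n"
    using Greatest_le_nat[of P] GreatestI_nat[of P 1 "card (verts G)"] P1 bound by metis
  obtain x p y where p: "path_between G x p y" "length p = n" using n(1) unfolding P_def by blast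
  have xV: "x \<in> verts G" using path_between_verts[OF p(1)] by simp
  \<comment> \<open>If \<open>p\<close> has a single vertex, \<open>hd (tl p)\<close> is
    unspecified, but then there is no edge at \<open>x\<close>.\<close>
  have "e = {x, hd (tl p)}" if e: "e \<in> edges G" "x \<in> e" for e
  proof -
    have "card e = 1 \<or> card e = 2" using e assms(1) by (auto simp: is_graph_def)
    then obtain z where z: "e = {x, z}" using e(2)
      by (auto simp: card_1_singleton_iff card_2_iff insert_commute)
    have zV: "z \<in> verts G" using e z assms(1) by (auto simp: is_graph_def)
    have xz: "x \<noteq> z" using loop_is_cycle[of x G] e(1) z xV assms(2) unfolding has_cycle_def by auto
    have "z \<in> set p"
    proof (rule ccontr)
      assume "z \<notin> set p"
      then have "path_between G z (z # p) y"
        using path_between_Cons[OF p(1) zV] e(1) z by (simp add: insert_commute)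
      then have "P (Suc n)" unfolding P_def using p(2) by (intro exI conjI) auto
      then show False using n(2)[of "Suc n"] by simp
    qed
    moreover obtain r where r: "p = x # r" using p(1) by (cases p) (auto simp: path_between_def)
    ultimately obtain as bs where s: "r = as @ z # bs" using xz by (auto dest: split_list)
    have "path_between G x ((x # as @ [z]) @ bs) y" using p(1) r s by simp
    then have "path_between G x (x # as @ [z]) z" using path_between_prefix[of G x "x # as @ [z]" bs y] by simp
    moreover from this have "path_between G x [x, z] z" using e(1) z by (auto simp: path_between_def)
    ultimately have "x # as @ [z] = [x, z]" by (rule acyclic_path_unique[OF assms(2)])
    then have "as = []" by simp
    then show ?thesis using z r s by simp
  qed
  then have "card {e \<in> edges G. x \<in> e} \<le> card {{x, hd (tl p)}}" by (intro card_mono) auto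
  then show ?thesis using xV by auto
qed

lemma acyclic_card_edges:
  assumes "is_graph G" "\<not> has_cycle G" "verts G \<noteq> {}"
  shows "card (edges G) < card (verts G)"
  using assms
proof (induction "card (verts G)" arbitrary: G rule: less_induct)
  case less
  obtain x where x: "x \<in> verts G" "card {e \<in> edges G. x \<in> e} \<le> 1"
    using acyclic_low_degree[OF less.prems] by blast
  let ?H = "delete_verts G {x}"
  have fin: "finite (verts G)" "finite (edges G)"
    using less.prems(1) finite_edges by (auto simp: is_graph_def)
  have card_V: "card (verts G) = Suc (card (verts ?H))"
    using card_Suc_Diff1[OF fin(1) x(1)] by (simp add: delete_verts_def)
  have "edges G = {e \<in> edges G. x \<in> e} \<union> edges ?H" by (auto simp: delete_verts_def)
  then have card_E: "card (edges G) \<le> card {e \<in> edges G. x \<in> e} + card (edges ?H)"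
    by (metis card_Un_le)
  show ?case
  proof (cases "verts ?H = {}")
    case True
    have "e = {x}" if "e \<in> edges G" for e
    proof -
      have "e \<subseteq> {x}" "e \<noteq> {}" using that less.prems(1) True by (auto simp: is_graph_def delete_verts_def)
      then show ?thesis by auto
    qed
    moreover have "{x} \<notin> edges G"
      using loop_is_cycle[of x G] x(1) less.prems(2) unfolding has_cycle_def by blast
    ultimately have "edges G = {}" by auto
    then show ?thesis using card_V by simp
  next
    case False
    have "\<not> has_cycle ?H" using less.prems(2) has_cycle_delete_verts by blast
    then have "card (edges ?H) < card (verts ?H)"
      using less.hyps[of ?H] card_V False is_graph_delete_verts[OF less.prems(1)] by simp
    then show ?thesis using card_E card_V x(2) by simp
  qed
qed

text \<open>Handshake lemma: an edge with two ends counts once at each, a loop twice at its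
  end.\<close>

lemma sum_vertex_degree:
  assumes "is_graph G"
  shows "(\<Sum>x\<in>verts G. vertex_degree G x) = 2 * card (edges G)"
proof -
  have fin: "finite (verts G)" "finite (edges G)"
    using assms finite_edges by (auto simp: is_graph_def)
  have c: "card {a \<in> S. P a} = (\<Sum>a\<in>S. if P a then 1 else 0)" if "finite S" for S :: "'b set" and P
    using that by (simp add: sum.If_cases Int_def)
  have "vertex_degree G x = (\<Sum>e\<in>edges G. (if x \<in> e then 1 else 0) + (if e = {x} then 1 else 0))" for x
    unfolding vertex_degree_def c[OF fin(2)] by (simp add: sum.distrib)
  then have "(\<Sum>x\<in>verts G. vertex_degree G x)
      = (\<Sum>e\<in>edges G. \<Sum>x\<in>verts G. (if x \<in> e then 1 else 0) + (if e = {x} then 1 else 0))"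
    by (simp add: sum.swap[of _ "edges G"])
  also have "\<dots> = (\<Sum>e\<in>edges G. 2)"
  proof (rule sum.cong[OF refl])
    fix e assume "e \<in> edges G"
    then have e: "e \<subseteq> verts G" "card e = 1 \<or> card e = 2" using assms by (auto simp: is_graph_def)
    have "{x \<in> verts G. x \<in> e} = e" using e by blast
    moreover have "card {x \<in> verts G. e = {x}} = (if card e = 1 then 1 else 0)"
    proof (cases "card e = 1")
      case True
      then obtain a where a: "e = {a}" by (rule card_1_singletonE)
      then have "{x \<in> verts G. e = {x}} = {a}" using e by auto
      then show ?thesis using a by simp
    next
      case False
      then have none: "{x \<in> verts G. e = {x}} = {}" by auto
      show ?thesis unfolding none using False by simp
    qed
    ultimately have "card {x \<in> verts G. x \<in> e} + card {x \<in> verts G. e = {x}} = 2" using e by auto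
    then show "(\<Sum>x\<in>verts G. (if x \<in> e then 1 else 0) + (if e = {x} then 1 else 0)) = (2::nat)"
      unfolding c[OF fin(1)] by (simp add: sum.distrib)
  qed
  finally show ?thesis by simp
qed

lemma sum_adj:
  assumes "is_graph G" "x \<in> verts G"
  shows "(\<Sum>z\<in>verts G. adj G x z) = vertex_degree G x"
proof -
  have fin: "finite (verts G)" using assms by (auto simp: is_graph_def)
  have c: "card {a \<in> verts G. P a} = (\<Sum>a\<in>verts G. if P a then 1 else 0)" for P
    using fin by (simp add: sum.If_cases Int_def)
  have "(\<Sum>z\<in>verts G. adj G x z)
    = (\<Sum>z\<in>verts G. (if {x, z} \<in> edges G then 1 else 0) + (if {x, z} \<in> edges G \<and> x = z then 1 else 0))"
    by (intro sum.cong) (auto simp: adj_def)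
  also have "\<dots> = card {z \<in> verts G. {x, z} \<in> edges G} + card {z \<in> verts G. {x, z} \<in> edges G \<and> x = z}"
    unfolding c by (simp add: sum.distrib)
  also have "card {z \<in> verts G. {x, z} \<in> edges G} = card {e \<in> edges G. x \<in> e}"
  proof (rule bij_betw_same_card[of "\<lambda>z. {x, z}"])
    have "e \<in> (\<lambda>z. {x, z}) ` {z \<in> verts G. {x, z} \<in> edges G}" if e: "e \<in> edges G" "x \<in> e" for e
    proof -
      have "card e = 1 \<or> card e = 2" "e \<subseteq> verts G" using e assms(1) by (auto simp: is_graph_def)
      then obtain z where "e = {x, z}" using e(2)
        by (auto simp: card_1_singleton_iff card_2_iff insert_commute)
      then show ?thesis using e \<open>e \<subseteq> verts G\<close> by auto
    qed
    then show "bij_betw (\<lambda>z. {x, z}) {z \<in> verts G. {x, z} \<in> edges G} {e \<in> edges G. x \<in> e}"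
      unfolding bij_betw_def inj_on_def by (auto simp: doubleton_eq_iff)
  qed
  also have "card {z \<in> verts G. {x, z} \<in> edges G \<and> x = z} = card {e \<in> edges G. e = {x}}"
  proof (cases "{x} \<in> edges G")
    case True
    then have "{z \<in> verts G. {x, z} \<in> edges G \<and> x = z} = {x}" "{e \<in> edges G. e = {x}} = {{x}}"
      using assms(2) by auto
    then show ?thesis by simp
  next
    case False
    then have none: "{z \<in> verts G. {x, z} \<in> edges G \<and> x = z} = {}" "{e \<in> edges G. e = {x}} = {}"
      by auto
    show ?thesis unfolding none by simp
  qed
  finally show ?thesis by (simp add: vertex_degree_def)
qed

text \<open>The indicator of \<open>T\<close> is a nonzero kernel vector of the adjacency matrix modulo 2.\<close>

definition even_kernel :: "'v ugraph \<Rightarrow> 'v set \<Rightarrow> bool" where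
  "even_kernel G T \<longleftrightarrow>
     T \<subseteq> verts G \<and> T \<noteq> {} \<and> (\<forall>x\<in>verts G. even (\<Sum>z\<in>T. adj G x z))"

text \<open>Modulo 2 only the row of \<open>u\<close> can fail. Adding \<open>v\<close>, adjacent to
  \<open>u\<close> alone, repairs it without affecting other rows.\<close>

lemma even_kernel_lift:
  assumes graph: "is_graph G" and leaf: "leaf_pair G u v"
    and T: "even_kernel (delete_verts G {u, v}) T"
  shows "\<exists>T. even_kernel G T"
proof -
  have uv: "u \<noteq> v" "u \<in> verts G" "v \<in> verts G" "{u, v} \<in> edges G" using leaf by (auto simp: leaf_pair_def)
  have TV: "T \<subseteq> verts G" "u \<notin> T" "v \<notin> T" "T \<noteq> {}"
    using T by (auto simp: even_kernel_def delete_verts_def)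
  have fin: "finite T" using TV(1) graph finite_subset unfolding is_graph_def by metis
  have av: "adj G v x = (if x = u then 1 else 0)" for x
  proof -
    have "{v, x} \<in> edges G \<longleftrightarrow> x = u"
      using leaf by (auto simp: leaf_pair_def doubleton_eq_iff insert_commute)
    then show ?thesis using uv by (simp add: adj_def)
  qed
  define T' where "T' = (if even (\<Sum>z\<in>T. adj G u z) then T else insert v T)"
  have sum: "(\<Sum>z\<in>T'. adj G x z) = (\<Sum>z\<in>T. adj G x z) + (if v \<in> T' \<and> x = u then 1 else 0)" for x
    using fin TV av[of x] adj_commute[of G x v] by (auto simp: T'_def)
  have "even (\<Sum>z\<in>T'. adj G x z)" if x: "x \<in> verts G" for x
  proof -
    consider "x = u" | "x = v" | "x \<in> verts (delete_verts G {u, v})" "x \<noteq> u" "x \<noteq> v"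
      using x by (auto simp: delete_verts_def)
    then show ?thesis
    proof cases
      case 1
      then show ?thesis unfolding sum using TV by (auto simp: T'_def)
    next
      case 2
      have "(\<Sum>z\<in>T. adj G v z) = 0" using TV av by (intro sum.neutral) auto
      then show ?thesis unfolding sum using 2 uv by simp
    next
      case 3
      have "(\<Sum>z\<in>T. adj G x z) = (\<Sum>z\<in>T. adj (delete_verts G {u, v}) x z)"
      proof (rule sum.cong[OF refl])
        fix z assume "z \<in> T"
        then have "z \<notin> {u, v}" using TV by auto
        then show "adj G x z = adj (delete_verts G {u, v}) x z"
          using 3 adj_delete_verts[of x "{u, v}" z G] by simp
      qed
      then show ?thesis unfolding sum using 3 T by (simp add: even_kernel_def)
    qed
  qed
  then have "even_kernel G T'" using TV uv by (auto simp: even_kernel_def T'_def)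
  then show ?thesis by blast
qed

text \<open>Without degrees 0 and 1 the degree sum is at least twice the number of vertices, and the
  edge bound makes it at most that. So all degrees are 2, and the row sums are even.\<close>

lemma irreducible_even_kernel:
  assumes graph: "is_graph G" and ne: "verts G \<noteq> {}" and irr: "\<And>H. \<not> K2_reduction G H"
    and card: "card (edges G) \<le> card (verts G)"
  shows "\<exists>T. even_kernel G T"
proof (cases "\<exists>x\<in>verts G. vertex_degree G x = 0")
  case True
  then obtain x where x: "x \<in> verts G" "vertex_degree G x = 0" by blast
  then have "{e \<in> edges G. x \<in> e} = {}" using finite_edges[OF graph] by (simp add: vertex_degree_def)
  then have "adj G w x = 0" for w by (auto simp: adj_def)
  then have "even_kernel G {x}" using x by (simp add: even_kernel_def)
  then show ?thesis by blast
next
  case False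
  have fin: "finite (verts G)" using graph by (simp add: is_graph_def)
  have deg: "2 \<le> vertex_degree G x" if x: "x \<in> verts G" for x
  proof -
    have "vertex_degree G x \<noteq> 1"
    proof
      assume d: "vertex_degree G x = 1"
      have "card {e \<in> edges G. e = {x}} \<le> card {e \<in> edges G. x \<in> e}"
        using finite_edges[OF graph] by (intro card_mono) auto
      then have "card {e \<in> edges G. x \<in> e} \<noteq> 0" using d by (auto simp: vertex_degree_def)
      then obtain e where e: "e \<in> edges G" "x \<in> e" by (metis (mono_tags, lifting) card.empty empty_Collect_eq)
      have "card e = 1 \<or> card e = 2" using e graph by (auto simp: is_graph_def)
      then obtain z where "e = {x, z}" using e(2)
        by (auto simp: card_1_singleton_iff card_2_iff insert_commute)
      then have "K2_reduction G (delete_verts G {z, x})"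
        using x d e(1) unfolding K2_reduction_def by blast
      then show False using irr by simp
    qed
    moreover have "vertex_degree G x \<noteq> 0" using False x by auto
    ultimately show ?thesis by linarith
  qed
  have "vertex_degree G x = 2" if x: "x \<in> verts G" for x
  proof (rule ccontr)
    assume "vertex_degree G x \<noteq> 2"
    then have "2 < vertex_degree G x" using deg[OF x] by simp
    then have "(\<Sum>x\<in>verts G. 2) < (\<Sum>x\<in>verts G. vertex_degree G x)"
      using deg x by (intro sum_strict_mono_ex1 fin) auto
    then show False using card by (simp add: sum_vertex_degree[OF graph])
  qed
  then have "even_kernel G (verts G)" using ne sum_adj[OF graph] by (simp add: even_kernel_def)
  then show ?thesis by blast
qed

text \<open>Acyclicity without \<open>f\<close> passes to reduced graphs, unlike connectedness;
  \<open>f\<close> need not be an edge of them. It also bounds the number of edges once no reduction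
  is left.\<close>

lemma not_K2_reducible_even_kernel:
  assumes "is_graph G" "\<not> has_cycle (delete_edges G {f})" "\<not> K2_reducible G"
  shows "\<exists>T. even_kernel G T"
  using assms
proof (induction "card (verts G)" arbitrary: G rule: less_induct)
  case less
  note graph = less.prems(1)
  show ?case
  proof (cases "\<exists>H. K2_reduction G H")
    case True
    then obtain H where H: "K2_reduction G H" by blast
    obtain u v where leaf: "leaf_pair G u v" and H_def: "H = delete_verts G {u, v}"
      by (rule K2_reduction_leaf_pair[OF graph H])
    have "verts H \<subset> verts G" using leaf by (auto simp: H_def leaf_pair_def delete_verts_def)
    then have "card (verts H) < card (verts G)" using graph by (simp add: is_graph_def psubset_card_mono)
    moreover have "\<not> K2_reducible H" using H less.prems(3) unfolding K2_reducible_def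
      by (metis converse_rtranclp_into_rtranclp)
    moreover have "subgraph_of (delete_edges H {f}) (delete_edges G {f})"
      by (auto simp: H_def subgraph_of_def delete_edges_def delete_verts_def)
    then have "\<not> has_cycle (delete_edges H {f})" using less.prems(2) has_cycle_mono by metis
    ultimately obtain T where "even_kernel H T"
      using less.hyps[of H] is_graph_delete_verts[OF graph] H_def by metis
    then show ?thesis using even_kernel_lift[OF graph leaf] H_def by simp
  next
    case False
    have ne: "verts G \<noteq> {}"
    proof
      assume "verts G = {}"
      moreover from this have "edges G = {}" using graph unfolding is_graph_def by fastforce
      ultimately have "G = empty_graph" by (cases G) (simp add: empty_graph_def)
      then show False using less.prems(3) by (simp add: K2_reducible_def)
    qed
    have "is_graph (delete_edges G {f})" using graph by (auto simp: is_graph_def delete_edges_def)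
    then have "card (edges G - {f}) < card (verts G)"
      using acyclic_card_edges[OF _ less.prems(2)] ne by (simp add: delete_edges_def)
    moreover have "card (edges G) \<le> Suc (card (edges G - {f}))"
      using card_Suc_Diff1[OF finite_edges[OF graph]] by (cases "f \<in> edges G") auto
    ultimately show ?thesis using irreducible_even_kernel[OF graph ne] False by simp
  qed
qed

section \<open>Inverse matrices and parity\<close>

lemma matrix_inv_inverse:
  fixes A :: "real ^ 'n ^ 'n"
  assumes "invertible A"
  shows "A ** matrix_inv A = mat 1" "matrix_inv A ** A = mat 1"
  using someI_ex[OF assms[unfolded invertible_def]] by (auto simp: matrix_inv_def)

lemma matrix_inv_eqI:
  fixes A B :: "real ^ 'n ^ 'n"
  assumes "A ** B = mat 1"
  shows "invertible A" "matrix_inv A = B"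
proof -
  show inv: "invertible A" using assms matrix_left_right_inverse unfolding invertible_def by blast
  have "matrix_inv A = matrix_inv A ** (A ** B)" using assms by simp
  also have "\<dots> = B" by (simp add: matrix_mul_assoc matrix_inv_inverse(2)[OF inv])
  finally show "matrix_inv A = B" .
qed

lemma adjacency_matrix_nth: "adjacency_matrix G $ x $ y = real (adj G x y)"
  by (simp add: adjacency_matrix_def adj_def)

text \<open>If t is the indicator of \<open>T\<close>, then A t = 2 k with k integral, so t = 2
  A^(-1) k would have only even entries, yet it has an entry 1.\<close>

lemma sign_invertible_no_even_kernel:
  assumes "sign_invertible G" "verts G = UNIV"
  shows "\<not> even_kernel G T"
proof
  assume T: "even_kernel G T"
  let ?A = "adjacency_matrix G"
  let ?B = "matrix_inv ?A"
  define t :: "real ^ 'a" where "t = (\<chi> z. if z \<in> T then 1 else 0)"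
  have BA: "?B ** ?A = mat 1" using assms(1) matrix_inv_inverse(2) by (auto simp: sign_invertible_def)
  have At: "\<exists>k. (?A *v t) $ x = 2 * real_of_int k" for x
  proof -
    have "(?A *v t) $ x = (\<Sum>z\<in>UNIV. if z \<in> T then real (adj G x z) else 0)"
      by (auto simp: matrix_vector_mult_def t_def adjacency_matrix_nth intro!: sum.cong)
    also have "\<dots> = real (\<Sum>z\<in>T. adj G x z)" by (simp add: sum.If_cases)
    finally have s: "(?A *v t) $ x = real (\<Sum>z\<in>T. adj G x z)" .
    have "even (\<Sum>z\<in>T. adj G x z)" using T assms(2) by (simp add: even_kernel_def)
    then obtain k where "(\<Sum>z\<in>T. adj G x z) = 2 * k" by (rule evenE)
    then have "(?A *v t) $ x = 2 * real_of_int (int k)" using s by simp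
    then show ?thesis by blast
  qed
  then have "\<exists>k. \<forall>x. (?A *v t) $ x = 2 * real_of_int (k x)" by (intro choice allI)
  then obtain k where k: "\<And>x. (?A *v t) $ x = 2 * real_of_int (k x)" by blast
  obtain x where x: "x \<in> T" using T by (auto simp: even_kernel_def)
  have "?B $ x $ z \<in> \<int>" for z
  proof -
    have "?B $ x $ z \<in> {-1, 0, 1}" using assms(1) by (simp add: sign_invertible_def)
    then show ?thesis by auto
  qed
  then have "(\<Sum>z\<in>UNIV. ?B $ x $ z * k z) \<in> \<int>" by (intro Ints_sum Ints_mult Ints_of_int)
  then obtain l where l: "(\<Sum>z\<in>UNIV. ?B $ x $ z * k z) = of_int l" by (rule Ints_cases)
  have "t = ?B *v (?A *v t)" using BA by (simp add: matrix_vector_mul_assoc)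
  then have "(?B *v (?A *v t)) $ x = t $ x" by simp
  have mv: "(?B *v w) $ x = (\<Sum>z\<in>UNIV. ?B $ x $ z * w $ z)" for w
    by (simp add: matrix_vector_mult_def)
  have "1 = (?B *v (?A *v t)) $ x"
    using x \<open>(?B *v (?A *v t)) $ x = t $ x\<close> by (simp add: t_def)
  also have "\<dots> = 2 * (\<Sum>z\<in>UNIV. ?B $ x $ z * k z)"
    unfolding mv k by (simp add: sum_distrib_left mult_ac)
  finally have "(1::real) = of_int (2 * l)" using l by simp
  then have "1 = 2 * l" by linarith
  then show False by presburger
qed

section \<open>Matchings and pegs\<close>

lemma mated_perfect_matching:
  assumes "mated G m"
  shows "perfect_matching G ((\<lambda>x. {x, m x}) ` verts G)"
  unfolding perfect_matching_def
proof (intro conjI ballI)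
  show "(\<lambda>x. {x, m x}) ` verts G \<subseteq> edges G" using assms by (auto simp: mated_def)
  show "card e = 2" if "e \<in> (\<lambda>x. {x, m x}) ` verts G" for e
    using that assms by (auto simp: mated_def card_2_iff)
  show "\<exists>!e. e \<in> (\<lambda>x. {x, m x}) ` verts G \<and> x \<in> e" if x: "x \<in> verts G" for x
  proof (rule ex1I[of _ "{x, m x}"])
    show "{x, m x} \<in> (\<lambda>x. {x, m x}) ` verts G \<and> x \<in> {x, m x}" using x by blast
    fix e assume "e \<in> (\<lambda>x. {x, m x}) ` verts G \<and> x \<in> e"
    then obtain y where "y \<in> verts G" "e = {y, m y}" "x = y \<or> x = m y" by auto
    then show "e = {x, m x}" using assms by (auto simp: mated_def insert_commute)
  qed
qed

lemma perfect_matching_unique: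
  assumes "perfect_matching G M" "x \<in> verts G" "e \<in> M" "x \<in> e" "e' \<in> M" "x \<in> e'"
  shows "e = e'"
proof -
  have "\<exists>!e. e \<in> M \<and> x \<in> e" using assms(1,2) by (simp add: perfect_matching_def)
  then show ?thesis using assms(3-6) by (auto elim!: ex1E)
qed

lemma perfect_matching_leaf_pair:
  assumes "leaf_pair G u v" "perfect_matching G M"
  shows "{u, v} \<in> M" "perfect_matching (delete_verts G {u, v}) (M - {{u, v}})"
proof -
  have M: "M \<subseteq> edges G" "\<And>e. e \<in> M \<Longrightarrow> card e = 2" "\<And>x. x \<in> verts G \<Longrightarrow> \<exists>!e. e \<in> M \<and> x \<in> e"
    using assms(2) by (auto simp: perfect_matching_def)
  have uv: "u \<in> verts G" "v \<in> verts G" and leaf: "\<And>e. e \<in> edges G \<Longrightarrow> v \<in> e \<Longrightarrow> e = {u, v}"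
    using assms(1) by (auto simp: leaf_pair_def)
  obtain e where "e \<in> M" "v \<in> e" using M(3)[OF uv(2)] by (elim ex1E conjE)
  then show uvM: "{u, v} \<in> M" using M(1) leaf[of e] by auto
  have disj: "e \<inter> {u, v} = {}" if e: "e \<in> M" "e \<noteq> {u, v}" for e
  proof -
    have "x \<notin> e" if "x \<in> verts G" "x \<in> {u, v}" for x
    proof
      assume "x \<in> e"
      then have "e = {u, v}" by (rule perfect_matching_unique[OF assms(2) that(1) e(1) _ uvM that(2)])
      then show False using e(2) by simp
    qed
    then have "u \<notin> e" "v \<notin> e" using uv by simp_all
    then show ?thesis by simp
  qed
  show "perfect_matching (delete_verts G {u, v}) (M - {{u, v}})"
    unfolding perfect_matching_def
  proof (intro conjI ballI)
    show "M - {{u, v}} \<subseteq> edges (delete_verts G {u, v})"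
      using M(1) disj by (auto simp: delete_verts_def)
    show "card e = 2" if "e \<in> M - {{u, v}}" for e using that M(2) by simp
    show "\<exists>!e. e \<in> M - {{u, v}} \<and> x \<in> e" if "x \<in> verts (delete_verts G {u, v})" for x
    proof -
      have x: "x \<in> verts G" "x \<noteq> u" "x \<noteq> v" using that by (auto simp: delete_verts_def)
      obtain e where e: "e \<in> M" "x \<in> e" using M(3)[OF x(1)] by (elim ex1E conjE)
      have "e \<noteq> {u, v}" using e(2) x by auto
      show ?thesis
      proof (rule ex1I[of _ e])
        show "e \<in> M - {{u, v}} \<and> x \<in> e" using e \<open>e \<noteq> {u, v}\<close> by simp
        show "e' = e" if "e' \<in> M - {{u, v}} \<and> x \<in> e'" for e'
          using that by (intro perfect_matching_unique[OF assms(2) x(1) _ _ e]) simp_all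
      qed
    qed
  qed
qed

text \<open>Leaf edges are forced into every perfect matching. Carrying this along gives the
  uniqueness behind the \<open>THE\<close> in \<open>the_perfect_matching\<close>.\<close>

lemma K2_reducible_mated:
  assumes "K2_reducible G" "is_graph G"
  shows "\<exists>m. mated G m \<and> (\<forall>M. perfect_matching G M \<longrightarrow> (\<forall>x\<in>verts G. {x, m x} \<in> M))"
  using assms
proof (induction rule: K2_reducible_induct)
  case empty
  show ?case by (simp add: mated_def empty_graph_def)
next
  case (step G u v)
  let ?H = "delete_verts G {u, v}"
  obtain m where m: "mated ?H m" "\<And>M x. perfect_matching ?H M \<Longrightarrow> x \<in> verts ?H \<Longrightarrow> {x, m x} \<in> M"
    using step.IH by blast
  have uv: "u \<noteq> v" "u \<in> verts G" "v \<in> verts G" "{u, v} \<in> edges G" "{v, u} \<in> edges G"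
    using step.hyps(2) by (auto simp: leaf_pair_def insert_commute)
  define m' where "m' = m(u := v, v := u)"
  have m'_uv: "m' u = v" "m' v = u" using uv by (auto simp: m'_def)
  have m'_H: "m' x = m x" if "x \<in> verts ?H" for x using that by (auto simp: m'_def delete_verts_def)
  have V: "x = u \<or> x = v \<or> x \<in> verts ?H" if "x \<in> verts G" for x
    using that by (auto simp: delete_verts_def)
  have "m' x \<in> verts G \<and> m' x \<noteq> x \<and> m' (m' x) = x \<and> {x, m' x} \<in> edges G" if x: "x \<in> verts G" for x
  proof (cases "x \<in> verts ?H")
    case True
    then have "m x \<in> verts ?H" "m x \<noteq> x" "m (m x) = x" "{x, m x} \<in> edges ?H"
      using m(1) by (auto simp: mated_def)
    then show ?thesis using m'_H[OF True] m'_H[of "m x"] by (auto simp: delete_verts_def)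
  next
    case False
    then have "x = u \<or> x = v" using V[OF x] by simp
    then show ?thesis using uv m'_uv by auto
  qed
  then have "mated G m'" by (simp add: mated_def)
  moreover have "{x, m' x} \<in> M" if M: "perfect_matching G M" and x: "x \<in> verts G" for M x
  proof (cases "x \<in> verts ?H")
    case True
    then show ?thesis
      using m(2)[OF perfect_matching_leaf_pair(2)[OF step.hyps(2) M] True] m'_H by simp
  next
    case False
    then have "x = u \<or> x = v" using V[OF x] by simp
    then show ?thesis using perfect_matching_leaf_pair(1)[OF step.hyps(2) M] m'_uv
      by (auto simp: insert_commute)
  qed
  ultimately show ?case by blast
qed

lemma K2_reducible_the_perfect_matching:
  assumes "K2_reducible G" "is_graph G"
  obtains m where "mated G m" "the_perfect_matching G = (\<lambda>x. {x, m x}) ` verts G"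
proof -
  obtain m where m: "mated G m" "\<And>M x. perfect_matching G M \<Longrightarrow> x \<in> verts G \<Longrightarrow> {x, m x} \<in> M"
    using K2_reducible_mated[OF assms] by blast
  have "M = (\<lambda>x. {x, m x}) ` verts G" if M: "perfect_matching G M" for M
  proof (intro equalityI subsetI)
    fix e assume e: "e \<in> M"
    then have "e \<subseteq> verts G" "card e = 2" using M assms(2) by (auto simp: perfect_matching_def is_graph_def)
    then obtain x where x: "x \<in> e" "x \<in> verts G" by (auto simp: card_2_iff)
    have "e = {x, m x}"
      by (rule perfect_matching_unique[OF M x(2) e x(1) m(2)[OF M x(2)]]) simp
    then show "e \<in> (\<lambda>x. {x, m x}) ` verts G" using x by blast
  qed (use m(2) M in auto)
  then have "the_perfect_matching G = (\<lambda>x. {x, m x}) ` verts G"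
    unfolding the_perfect_matching_def
    using mated_perfect_matching[OF m(1)] by (intro the_equality)
  then show ?thesis using that m(1) by blast
qed

text \<open>A peg has one end on the cycle and the mate of that end off it, so it is determined by
  its attachment.\<close>

lemma pegs_exposed:
  assumes m: "mated G m" and M: "the_perfect_matching G = (\<lambda>x. {x, m x}) ` verts G"
    and sub: "verts Q \<subseteq> verts G"
  shows "card (pegs G Q) = card (exposed m (verts Q))"
    and "peg_attachments G Q = exposed m (verts Q)"
proof -
  let ?S = "verts Q"
  have mm: "m x \<in> verts G" "m x \<noteq> x" "m (m x) = x" if "x \<in> verts G" for x
    using m that by (auto simp: mated_def)
  have att: "{x, m x} \<inter> ?S = {x}" if "x \<in> exposed m ?S" for x
    using that by (auto simp: exposed_def)
  have eq: "pegs G Q = (\<lambda>x. {x, m x}) ` exposed m ?S"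
  proof (intro equalityI subsetI)
    fix e assume "e \<in> pegs G Q"
    then obtain x where x: "x \<in> verts G" "e = {x, m x}" "card (e \<inter> ?S) = 1"
      unfolding pegs_def M by auto
    have "\<not> (x \<in> ?S \<and> m x \<in> ?S)"
    proof
      assume "x \<in> ?S \<and> m x \<in> ?S"
      then have "e \<inter> ?S = {x, m x}" using x(2) by auto
      then show False using x(3) mm(2)[OF x(1)] by simp
    qed
    moreover have "x \<in> ?S \<or> m x \<in> ?S"
    proof (rule ccontr)
      assume "\<not> ?thesis"
      then have "e \<inter> ?S = {}" using x(2) by auto
      then show False using x(3) by simp
    qed
    ultimately have "x \<in> exposed m ?S \<or> m x \<in> exposed m ?S"
      using mm(3)[OF x(1)] by (auto simp: exposed_def)
    then show "e \<in> (\<lambda>x. {x, m x}) ` exposed m ?S"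
      using x(2) mm(3)[OF x(1)] by (auto simp: insert_commute intro: image_eqI[of _ _ "m x"])
  next
    fix e assume "e \<in> (\<lambda>x. {x, m x}) ` exposed m ?S"
    then obtain x where x: "x \<in> exposed m ?S" "e = {x, m x}" by auto
    then have "x \<in> verts G" using sub by (auto simp: exposed_def)
    then show "e \<in> pegs G Q" using att[OF x(1)] x(2) by (simp add: pegs_def M)
  qed
  have "inj_on (\<lambda>x. {x, m x}) (exposed m ?S)"
    by (rule inj_onI) (metis att singleton_inject)
  then show "card (pegs G Q) = card (exposed m ?S)" unfolding eq by (rule card_image)
  have "peg_attachments G Q = (\<Union>x\<in>exposed m ?S. {x, m x} \<inter> ?S)"
    unfolding peg_attachments_def eq by (simp only: image_image)
  also have "\<dots> = (\<Union>x\<in>exposed m ?S. {x})" by (rule SUP_cong[OF refl att])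
  finally show "peg_attachments G Q = exposed m ?S" by simp
qed

section \<open>The two arcs between vertices of a cycle\<close>

lemma path_edges_card:
  "distinct p \<Longrightarrow> e \<in> path_edges p \<Longrightarrow> card e = 2"
proof (induction p)
  case (Cons a p)
  then show ?case by (cases p) auto
qed simp

text \<open>Only the first edge of the path contains \<open>a\<close>, so that edge would have to
  lead to \<open>b\<close>.\<close>

lemma end_edge_path:
  assumes "distinct (a # as @ [b])" "{a, b} \<in> path_edges (a # as @ [b])"
  shows "as = []"
proof (cases as)
  case (Cons c r)
  then have "{a, b} = {a, c} \<or> {a, b} \<in> path_edges (c # r @ [b])" using assms(2) by simp
  moreover have "{a, b} \<notin> path_edges (c # r @ [b])"
    using path_edges_subset_set[of "{a, b}" "c # r @ [b]"] assms(1) Cons by auto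
  ultimately show ?thesis using assms(1) Cons by (auto simp: doubleton_eq_iff)
qed simp

text \<open>The second arc runs backwards from \<open>a\<close>, across the closing edge.\<close>

lemma cycle_arcs:
  assumes dist: "distinct (a # as @ b # bs)" and len: "length (a # as @ b # bs) \<noteq> 2"
  shows "separates_into (cycle_of (a # as @ b # bs)) a b (a # as @ [b]) (a # rev bs @ [b])"
proof -
  let ?p = "a # as @ [b]" and ?q = "a # rev bs @ [b]" and ?C = "cycle_of (a # as @ b # bs)"
  have pe: "path_edges (a # as @ b # bs) = path_edges ?p \<union> path_edges (b # bs)"
  proof (cases bs)
    case Nil
    then show ?thesis by simp
  next
    case (Cons c r)
    then show ?thesis using path_edges_append[of ?p bs] by (auto simp: path_edges_Cons)
  qed
  have "path_edges ?q = path_edges (b # bs @ [a])" using path_edges_rev[of "b # bs @ [a]"] by simp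
  also have "\<dots> = insert {last (b # bs), a} (path_edges (b # bs))"
    using path_edges_append[of "b # bs" "[a]"] by simp
  finally have qe: "path_edges ?q = insert {last (b # bs), a} (path_edges (b # bs))" .
  have un: "path_edges ?p \<union> path_edges ?q = edges ?C" unfolding qe by (simp add: pe)
  have dp: "distinct ?p" "distinct ?q" using dist by auto
  have int: "set ?p \<inter> set ?q = {a, b}" using dist by auto
  \<comment> \<open>A common edge lies within the common vertices, so it is \<open>{a, b}\<close>
    and both arcs shrink to it; this is the excluded length 2.\<close>
  have "path_edges ?p \<inter> path_edges ?q = {}"
  proof (rule ccontr)
    assume "path_edges ?p \<inter> path_edges ?q \<noteq> {}"
    then obtain e where e: "e \<in> path_edges ?p" "e \<in> path_edges ?q" by blast
    then have "e \<subseteq> {a, b}" using path_edges_subset_set int by blast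
    moreover have "card e = 2" "card {a, b} = 2" using path_edges_card[OF dp(1) e(1)] dist by auto
    ultimately have "e = {a, b}" by (intro card_subset_eq) auto
    then have "as = []" "rev bs = []" using end_edge_path[OF dp(1)] end_edge_path[OF dp(2)] e by simp_all
    then show False using len by simp
  qed
  moreover have "set ?p \<union> set ?q = verts ?C" by auto
  moreover have "path_between ?C a ?p b" "path_between ?C a ?q b"
  proof -
    have "path_edges ?p \<subseteq> edges ?C" "path_edges ?q \<subseteq> edges ?C" unfolding un[symmetric] by simp_all
    moreover have "set ?p \<subseteq> verts ?C" "set ?q \<subseteq> verts ?C" by auto
    ultimately show "path_between ?C a ?p b" "path_between ?C a ?q b"
      unfolding path_between_def using dp by simp_all
  qed
  ultimately show ?thesis unfolding separates_into_def using un int by (intro conjI)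
qed

text \<open>The summand 2 comes from the ends, which both arcs contain.\<close>

lemma separates_into_length:
  assumes "separates_into C a b p q" "a \<noteq> b"
  shows "length p + length q = card (verts C) + 2"
proof -
  have "card (set p) + card (set q) = card (set p \<union> set q) + card (set p \<inter> set q)"
    by (rule card_Un_Int) auto
  then show ?thesis using assms by (auto simp: separates_into_def path_between_def distinct_card)
qed

text \<open>Writing p = 2i and q = 2j, both sides say that i + j is odd.\<close>

lemma even_sum_mod_4:
  fixes p q n :: nat
  assumes "even p" "even q" "p + q = n + 2"
  shows "p mod 4 \<noteq> q mod 4 \<longleftrightarrow> 4 dvd n"
proof -
  obtain i j where ij: "p = 2 * i" "q = 2 * j" using assms(1,2) by (auto elim!: evenE)
  have "p mod 4 \<noteq> q mod 4 \<longleftrightarrow> odd (i + j)" unfolding ij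
    by presburger
  moreover have "n + 2 = 2 * (i + j)" using assms(3) ij by simp
  ultimately show ?thesis by presburger
qed

text \<open>Unlike in \<open>mated_leaf_pair\<close>, the mate of \<open>u\<close> need not be a
  leaf; an arbitrary attachment requires this.\<close>

lemma mated_delete_pair:
  assumes "mated G m" "u \<in> verts G"
  shows "mated (delete_verts G {u, m u}) m"
  unfolding mated_def
proof
  fix x assume "x \<in> verts (delete_verts G {u, m u})"
  then have x: "x \<in> verts G" "x \<noteq> u" "x \<noteq> m u" by (auto simp: delete_verts_def)
  moreover have "m (m u) = u" "m (m x) = x" using assms x by (auto simp: mated_def)
  then have "m x \<noteq> u" "m x \<noteq> m u" using x by metis+
  ultimately show "m x \<in> verts (delete_verts G {u, m u}) \<and> m x \<noteq> x \<and> m (m x) = x \<and>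
      {x, m x} \<in> edges (delete_verts G {u, m u})"
    using assms(1) by (auto simp: mated_def delete_verts_def)
qed

text \<open>The arcs between two pegs always have even length, since \<open>m\<close> matches their inner vertices
  among themselves; so only the length of the cycle modulo 4 matters.\<close>

lemma two_exposed_arcs:
  assumes m: "mated G m" and Q: "is_cycle Q" "subgraph_of Q G"
    and uniq: "\<And>C. is_cycle C \<Longrightarrow> subgraph_of C G \<Longrightarrow> C = Q"
    and card: "card (exposed m (verts Q)) = 2"
  shows "4 dvd card (verts Q) \<longleftrightarrow>
    (\<exists>v1 v2 p q. v1 \<noteq> v2 \<and> exposed m (verts Q) = {v1, v2} \<and> separates_into Q v1 v2 p q \<and>
      even (length p) \<and> even (length q) \<and> length p mod 4 \<noteq> length q mod 4)"
proof
  assume "\<exists>v1 v2 p q. v1 \<noteq> v2 \<and> exposed m (verts Q) = {v1, v2} \<and> separates_into Q v1 v2 p q \<and>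
      even (length p) \<and> even (length q) \<and> length p mod 4 \<noteq> length q mod 4"
  then obtain v1 v2 p q where "v1 \<noteq> v2" "separates_into Q v1 v2 p q"
    "even (length p)" "even (length q)" "length p mod 4 \<noteq> length q mod 4"
    by (elim exE conjE)
  moreover from this have "length p + length q = card (verts Q) + 2"
    by (intro separates_into_length)
  ultimately show "4 dvd card (verts Q)" using even_sum_mod_4 by metis
next
  assume four: "4 dvd card (verts Q)"
  obtain a b where ab: "exposed m (verts Q) = {a, b}" "a \<noteq> b" using card by (auto simp: card_2_iff)
  then have "a \<in> exposed m (verts Q)" "b \<in> exposed m (verts Q)" by simp_all
  then have ex: "a \<in> verts Q" "m a \<notin> verts Q" "b \<in> verts Q" "m b \<notin> verts Q"
    by (simp_all add: exposed_def)
  obtain ys where ys: "distinct (a # ys)" "length (a # ys) \<noteq> 2" "Q = cycle_of (a # ys)"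
    by (rule cycle_through_vertex[OF Q(1) ex(1)])
  then have "b \<in> set ys" using ex(3) ab(2) by simp
  then obtain as bs where s: "ys = as @ b # bs" by (meson split_list)
  \<comment> \<open>Removing the attachment and its mate breaks the only cycle but keeps the rest of
    it as a path, so \<open>mated_path_split\<close> applies around \<open>b\<close>.\<close>
  let ?H = "delete_verts G {a, m a}"
  have aV: "a \<in> verts G" using ex Q(2) by (auto simp: subgraph_of_def)
  have "\<not> has_cycle ?H"
  proof
    assume "has_cycle ?H"
    then obtain C where C: "is_cycle C" "subgraph_of C ?H" unfolding has_cycle_def by blast
    have "C = Q" using uniq[OF C(1) subgraph_trans[OF C(2) subgraph_delete_verts]] .
    then show False using C(2) ex(1) by (auto simp: subgraph_of_def delete_verts_def)
  qed
  moreover have "path_between ?H (hd ys) (as @ b # bs) (last ys)"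
  proof -
    have "ys \<noteq> []" using s by simp
    then have "path_between G (hd ys) ys (last ys)"
      using Q(2) ys by (auto simp: path_between_def subgraph_of_def path_edges_Cons)
    moreover have "set ys \<inter> {a, m a} = {}" using ys(1,3) ex(2) by auto
    ultimately show ?thesis using path_between_delete[of G "hd ys" ys "last ys" "{a, m a}"] s by simp
  qed
  moreover have "\<forall>w\<in>set as \<union> set bs. m w \<in> set (as @ b # bs)"
  proof
    fix w assume w: "w \<in> set as \<union> set bs"
    then have "w \<in> verts Q" "w \<noteq> a" "w \<noteq> b" using ys s by auto
    then have "m w \<in> verts Q" using ab(1) by (auto simp: exposed_def)
    moreover have "m (m w) = w" using \<open>w \<in> verts Q\<close> Q(2) m by (auto simp: subgraph_of_def mated_def)
    then have "m w \<noteq> a" using ex(2) \<open>w \<in> verts Q\<close> by metis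
    ultimately show "m w \<in> set (as @ b # bs)" using ys(3) s by auto
  qed
  moreover have "m b \<notin> set (as @ b # bs)" using ex(4) ys(3) s by auto
  ultimately have "alternating m (rev as)" "alternating m bs"
    using mated_path_split[OF _ mated_delete_pair[OF m aV]] by blast+
  then have even: "even (length as)" "even (length bs)" using alternating_even_length by fastforce+
  let ?p = "a # as @ [b]" and ?q = "a # rev bs @ [b]"
  have sep: "separates_into Q a b ?p ?q" using cycle_arcs[of a as b bs] ys s by simp
  have "length ?p + length ?q = card (verts Q) + 2" by (rule separates_into_length[OF sep ab(2)])
  moreover have ev: "even (length ?p)" "even (length ?q)" using even by simp_all
  ultimately have "length ?p mod 4 \<noteq> length ?q mod 4" using four even_sum_mod_4 by metis
  then show "\<exists>v1 v2 p q. v1 \<noteq> v2 \<and> exposed m (verts Q) = {v1, v2} \<and> separates_into Q v1 v2 p q \<and>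
      even (length p) \<and> even (length q) \<and> length p mod 4 \<noteq> length q mod 4"
    using ab sep ev by (intro exI conjI)
qed

theorem theorem5p6:
  fixes G Q :: "('v::finite) ugraph"
  assumes "is_graph G" and "verts G = UNIV"
    and "unicyclic G"
    and "is_cycle Q" and "subgraph_of Q G"
  shows "sign_invertible G \<longleftrightarrow>
    K2_reducible G \<and> card (pegs G Q) \<ge> 2 \<and>
    (card (pegs G Q) = 2 \<longrightarrow>
      (\<exists>v1 v2 p q. v1 \<noteq> v2 \<and> peg_attachments G Q = {v1, v2} \<and>
         separates_into Q v1 v2 p q \<and>
         even (length p) \<and> even (length q) \<and> length p mod 4 \<noteq> length q mod 4))"
proof -
  obtain f where f: "\<not> has_cycle (delete_edges G {f})"
    by (rule unicyclic_acyclic_edge[OF assms(3)])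
  have uniq: "C = Q" if "is_cycle C" "subgraph_of C G" for C
    using unique_cycle[OF f that assms(4,5)] .
  show ?thesis
  proof (cases "K2_reducible G")
    case False
    obtain T where "even_kernel G T"
      using not_K2_reducible_even_kernel[OF assms(1) f False] by (elim exE)
    then have "\<not> sign_invertible G" using sign_invertible_no_even_kernel[OF _ assms(2)] by auto
    then show ?thesis using False by simp
  next
    case True
    obtain m where m: "mated G m" "the_perfect_matching G = (\<lambda>x. {x, m x}) ` verts G"
      by (rule K2_reducible_the_perfect_matching[OF True assms(1)])
    have "\<exists>B. inverse_on G B \<and> (\<forall>x y. B x y \<noteq> 0 \<longrightarrow> linked G x y) \<and>
      (if sign_good m (verts Q) then (\<forall>x y. B x y \<in> {-1, 0, 1}) \<and> (\<forall>x. B x x = 0)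
       else (\<exists>x y. B x y \<notin> {-1, 0, 1}))"
      by (rule unicyclic_inverse[OF True assms(1) m(1) assms(4,5)]) (rule uniq)
    then obtain B where B: "inverse_on G B"
      "if sign_good m (verts Q) then (\<forall>x y. B x y \<in> {-1, 0, 1}) \<and> (\<forall>x. B x x = 0)
       else (\<exists>x y. B x y \<notin> {-1, 0, 1})"
      by (elim exE conjE)
    have "\<forall>x\<in>verts G. \<forall>y\<in>verts G. (\<Sum>z\<in>verts G. real (adj G x z) * B z y) = of_bool (x = y)"
      using B(1) unfolding inverse_on_def by (elim conjE)
    \<comment> \<open>As \<open>verts G\<close> is the whole type, the sums in
      \<open>inverse_on\<close> are the entries of the matrix product.\<close>
    then have "adjacency_matrix G ** (\<chi> x y. B x y) = mat 1"
      by (simp add: matrix_matrix_mult_def adjacency_matrix_nth mat_def vec_eq_iff assms(2))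
    note inv = matrix_inv_eqI[OF this]
    have "sign_invertible G \<longleftrightarrow> (\<forall>x y. B x y \<in> {-1, 0, 1})"
      unfolding sign_invertible_def inv(2) by (simp only: inv(1) vec_lambda_beta simp_thms)
    also have "\<dots> \<longleftrightarrow> sign_good m (verts Q)"
    proof (cases "sign_good m (verts Q)")
      case True
      then show ?thesis using B(2) by simp
    next
      case False
      then have "\<exists>x y. B x y \<notin> {-1, 0, 1}" using B(2) by simp
      then show ?thesis using False by simp
    qed
    also have "\<dots> \<longleftrightarrow> card (exposed m (verts Q)) \<ge> 2 \<and> (card (exposed m (verts Q)) = 2 \<longrightarrow>
      (\<exists>v1 v2 p q. v1 \<noteq> v2 \<and> exposed m (verts Q) = {v1, v2} \<and>
         separates_into Q v1 v2 p q \<and>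
         even (length p) \<and> even (length q) \<and> length p mod 4 \<noteq> length q mod 4))"
      unfolding sign_good_def
      by (intro conj_cong refl imp_cong two_exposed_arcs[OF m(1) assms(4,5)]) (rule uniq)
    finally have "sign_invertible G \<longleftrightarrow>
      card (exposed m (verts Q)) \<ge> 2 \<and> (card (exposed m (verts Q)) = 2 \<longrightarrow>
      (\<exists>v1 v2 p q. v1 \<noteq> v2 \<and> exposed m (verts Q) = {v1, v2} \<and>
         separates_into Q v1 v2 p q \<and>
         even (length p) \<and> even (length q) \<and> length p mod 4 \<noteq> length q mod 4))" .
    moreover have "verts Q \<subseteq> verts G" using assms(2) by simp
    note pegs_exposed[OF m this]
    ultimately show ?thesis using True by simp
  qed
qed

end
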